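(* Let $(\mathcal{X},\rho,\mu)$ be a space of homogeneous type satisfying the weak reverse doubling (WRD) condition and let $\Omega\subseteq\mathcal{X}$ be an open set satisfying the weak measure density (WMD) condition. Let $p\in(0,\infty)$, $\beta\in(0,\infty)$, and let $\phi\in\mathcal{G}^{\rm dec}_p$ satisfy both the nearness condition and that there exists $C_{(\phi)}\in(0,\infty)$ such that, for any $x\in\mathcal{X}$ and $r\in(0,\infty)$, $\int_r^\infty\frac{\phi(x,t)}{t}\,dt\le C_{(\phi)}\phi(x,r)$. Assume either that there exists $\widetilde{C}_{(\phi)}\in[1,\infty)$ such that, for any ball $B\subset\mathcal{X}$, $\frac1{\widetilde C_{(\phi)}}\le\phi(B)[\mu(B)]^{\frac1p}\le\widetilde C_{(\phi)}$, or that both $\lim_{r\to0^+}\inf_{x\in B}\phi(x,r)=\infty$ for any ball $B\subset\mathcal{X}$ and $\lim_{r\to\infty}\phi(x,r)[\mu(B(x,r))]^{\frac1p}=\infty$ for any $x\in\mathcal{X}$. Then there exist $C,\widetilde C\in(0,\infty)$ such that, for any $f\in C^\beta_{\mathrm b}(\Omega)\cap\bigcup_{s\in(0,1)}\dot W^{s,p}_{L_{p,\phi}}(\Omega)$, $$C\|f\|_{L_{p,\phi}(\Omega)}\le\liminf_{s\to0^+}s^{\frac1p}\left\|\left\{\int_\Omega\frac{|f(\cdot)-f(y)|^p}{U(\cdot,y)[\rho(\cdot,y)]^{sp}}\,d\mu(y)\right\}^{\frac1p}\right\|_{L_{p,\phi}(\Omega)}\le\limsup_{s\to0^+}s^{\frac1p}\left\|\left\{\int_\Omega\frac{|f(\cdot)-f(y)|^p}{U(\cdot,y)[\rho(\cdot,y)]^{sp}}\,d\mu(y)\right\}^{\frac1p}\right\|_{L_{p,\phi}(\Omega)}\le\widetilde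 C\|f\|_{L_{p,\phi}(\Omega)}.$$
   Context: A quasi-metric on a nonempty set $\mathcal{X}$ is $\rho:\mathcal{X}\times\mathcal{X}\to[0,\infty)$ with $\rho(x,y)=0$ iff $x=y$, $\rho(x,y)=\rho(y,x)$, and $\rho(x,z)\le K_0[\rho(x,y)+\rho(y,z)]$ for some constant $K_0\in[1,\infty)$. Balls: $B(x,r):=\{y:\rho(x,y)<r\}$. $(\mathcal{X},\rho,\mu)$ is a space of homogeneous type if $\rho$ is a quasi-metric, $\mu$ is a nonnegative measure on a $\sigma$-algebra containing all balls, and there is $L_{(\mu)}\in[1,\infty)$ with $0<\mu(B(x,2r))\le L_{(\mu)}\mu(B(x,r))<\infty$ for all $x,r$. WRD condition: there exist $x_0\in\mathcal{X}$ and $\lambda,C_{(\mu)}\in(1,\infty)$ with $\liminf_{r\to\infty}\frac{\mu(B(x_0,\lambda r))}{\mu(B(x_0,r))}\ge C_{(\mu)}$. WMD condition for $\Omega$: there exist $x_0\in\mathcal{X}$ and $C_0\in(0,1]$ with $\liminf_{r\to\infty}\frac{\mu(B(x_0,r)\cap\Omega)}{\mu(B(x_0,r))}\ge C_0$. $U(x,y):=\min\{\mu(B(x,\rho(x,y))),\mu(B(y,\rho(x,y)))\}$. The integrand $|f(x)-f(y)|^p/(U(x,y)[\rho(x,y)]^{sp})$ is read as $0$ at $y=x$. For $\phi:\mathcal{X}\times(0,\infty)\to(0,\infty)$ and a ball $B=B(x,r)$, write $\phi(B):=\phi(x,r)$. $\phi$ satisfies the nearness condition if there is $C>0$ with $\frac1C\le\frac{\phi(x,r)}{\phi(y,r)}\le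 C$ whenever $\rho(x,y)\le r$. A function $\psi:\mathcal{X}\times(0,\infty)\to(0,\infty)$ is almost increasing (resp. almost decreasing) in $r$ if there is $C>0$ with $\psi(x,r)\le C\psi(x,s)$ (resp. $C\psi(x,r)\ge\psi(x,s)$) for all $x\in\mathcal{X}$ and $0<r<s<\infty$. $\mathcal{G}^{\rm dec}_p$ is the set of $\phi:\mathcal{X}\times(0,\infty)\to(0,\infty)$ such that $r\mapsto[\mu(B(x,r))]^{1/p}\phi(x,r)$ is almost increasing and $r\mapsto\phi(x,r)$ is almost decreasing. $L_{p,\phi}(\mathcal{X})$ (generalized Morrey space): all $f\in L^p_{\mathrm{loc}}(\mathcal{X})$ (measurable $f$ such that each $x\in\mathcal{X}$ has some $r_x>0$ with $f\mathbf{1}_{B(x,r_x)}\in L^p(\mathcal{X})$) with $\|f\|_{L_{p,\phi}(\mathcal{X})}:=\sup_B\frac1{\phi(B)}[\frac1{\mu(B)}\int_B|f|^p\,d\mu]^{1/p}<\infty$, supremum over all balls. For $Y=L_{p,\phi}$: $Y(\Omega)$ is the set of measurable $f$ on $\Omega$ that are restrictions of some $g\in Y(\mathcal{X})$, with $\|f\|_{Y(\Omega)}:=\inf\{\|g\|_{Y(\mathcal{X})}:g\in Y(\mathcal{X}),g|_\Omega=f\}$ (and $\infty$ if no such $g$); $\dot W^{s,p}_Y(\Omega)$ is the set of measurable $f$ on $\Omega$ with $\big\|\{\int_\Omega\frac{|f(\cdot)-f(y)|^p}{U(\cdot,y)[\rho(\cdot,y)]^{sp}}d\mu(y)\}^{1/p}\big\|_{Y(\Omega)}<\infty$.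 $C^\beta_{\mathrm b}(\mathcal{X})$: complex-valued functions $g$ on $\mathcal{X}$ with bounded support $\{g\ne0\}$ and $\sup_{x\ne y}|g(x)-g(y)|/[\rho(x,y)]^\beta<\infty$. $C^\beta_{\mathrm b}(\Omega)$: functions $f$ on $\Omega$ for which there is $g\in C^\beta_{\mathrm b}(\mathcal{X})$ with $g=f$ on $\Omega$ and $g\equiv0$ on $\mathcal{X}\setminus\Omega$. $s\to0^+$ means $s\in(0,1)$, $s\to0$. *)

theory Defs
  imports "HOL-Analysis.Analysis"
begin

text \<open>
  The underlying set is \<open>space M\<close>; the values of \<open>\<rho>\<close>, \<open>\<phi>\<close> and of functions outside it (for functions
  on \<open>\<Omega>\<close>: outside \<open>\<Omega>\<close>; for \<open>\<phi>\<close> and \<open>\<psi>\<close>: also at radii that are not positive) are irrelevant.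
\<close>

definition quasi_metric_on :: "'a set \<Rightarrow> ('a \<Rightarrow> 'a \<Rightarrow> real) \<Rightarrow> bool" where
  "quasi_metric_on X \<rho> \<longleftrightarrow>
     X \<noteq> {} \<and>
     (\<forall>x\<in>X. \<forall>y\<in>X. 0 \<le> \<rho> x y \<and> (\<rho> x y = 0 \<longleftrightarrow> x = y) \<and> \<rho> x y = \<rho> y x) \<and>
     (\<exists>K\<^sub>0\<ge>1. \<forall>x\<in>X. \<forall>y\<in>X. \<forall>z\<in>X. \<rho> x z \<le> K\<^sub>0 * (\<rho> x y + \<rho> y z))"

definition qball :: "'a set \<Rightarrow> ('a \<Rightarrow> 'a \<Rightarrow> real) \<Rightarrow> 'a \<Rightarrow> real \<Rightarrow> 'a set" where
  "qball X \<rho> x r = {y\<in>X. \<rho> x y < r}"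

text \<open>Balls of a quasi-metric need not be open in this sense.\<close>

definition qopen :: "'a set \<Rightarrow> ('a \<Rightarrow> 'a \<Rightarrow> real) \<Rightarrow> 'a set \<Rightarrow> bool" where
  "qopen X \<rho> \<Omega> \<longleftrightarrow> \<Omega> \<subseteq> X \<and> (\<forall>x\<in>\<Omega>. \<exists>r>0. qball X \<rho> x r \<subseteq> \<Omega>)"

definition homogeneous_type :: "'a measure \<Rightarrow> ('a \<Rightarrow> 'a \<Rightarrow> real) \<Rightarrow> bool" where
  "homogeneous_type M \<rho> \<longleftrightarrow>
     quasi_metric_on (space M) \<rho> \<and>
     (\<forall>x\<in>space M. \<forall>r>0. qball (space M) \<rho> x r \<in> sets M) \<and>
     (\<exists>L::real. 1 \<le> L \<and> (\<forall>x\<in>space M. \<forall>r>0.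
        0 < emeasure M (qball (space M) \<rho> x (2 * r)) \<and>
        emeasure M (qball (space M) \<rho> x (2 * r)) \<le> ennreal L * emeasure M (qball (space M) \<rho> x r) \<and>
        ennreal L * emeasure M (qball (space M) \<rho> x r) < \<infinity>))"

definition weak_reverse_doubling :: "'a measure \<Rightarrow> ('a \<Rightarrow> 'a \<Rightarrow> real) \<Rightarrow> bool" where
  "weak_reverse_doubling M \<rho> \<longleftrightarrow>
     (\<exists>x\<^sub>0\<in>space M. \<exists>\<Lambda>>1. \<exists>C>1.
        ennreal C \<le> Liminf at_top (\<lambda>r.
          emeasure M (qball (space M) \<rho> x\<^sub>0 (\<Lambda> * r)) / emeasure M (qball (space M) \<rho> x\<^sub>0 r)))"

definition weak_measure_density :: "'a measure \<Rightarrow> ('a \<Rightarrow> 'a \<Rightarrow> real) \<Rightarrow> 'a set \<Rightarrow> bool" where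
  "weak_measure_density M \<rho> \<Omega> \<longleftrightarrow>
     (\<exists>x\<^sub>0\<in>space M. \<exists>C\<^sub>0. 0 < C\<^sub>0 \<and> C\<^sub>0 \<le> 1 \<and>
        ennreal C\<^sub>0 \<le> Liminf at_top (\<lambda>r.
          emeasure M (qball (space M) \<rho> x\<^sub>0 r \<inter> \<Omega>) / emeasure M (qball (space M) \<rho> x\<^sub>0 r)))"

definition positive_radial :: "'a set \<Rightarrow> ('a \<Rightarrow> real \<Rightarrow> real) \<Rightarrow> bool" where
  "positive_radial X \<psi> \<longleftrightarrow> (\<forall>x\<in>X. \<forall>r>0. 0 < \<psi> x r)"

definition nearness :: "'a set \<Rightarrow> ('a \<Rightarrow> 'a \<Rightarrow> real) \<Rightarrow> ('a \<Rightarrow> real \<Rightarrow> real) \<Rightarrow> bool" where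
  "nearness X \<rho> \<phi> \<longleftrightarrow>
     (\<exists>C>0. \<forall>x\<in>X. \<forall>y\<in>X. \<forall>r>0. \<rho> x y \<le> r \<longrightarrow> 1 / C \<le> \<phi> x r / \<phi> y r \<and> \<phi> x r / \<phi> y r \<le> C)"

definition almost_increasing :: "'a set \<Rightarrow> ('a \<Rightarrow> real \<Rightarrow> real) \<Rightarrow> bool" where
  "almost_increasing X \<psi> \<longleftrightarrow> (\<exists>C>0. \<forall>x\<in>X. \<forall>r s. 0 < r \<and> r < s \<longrightarrow> \<psi> x r \<le> C * \<psi> x s)"

definition almost_decreasing :: "'a set \<Rightarrow> ('a \<Rightarrow> real \<Rightarrow> real) \<Rightarrow> bool" where
  "almost_decreasing X \<psi> \<longleftrightarrow> (\<exists>C>0. \<forall>x\<in>X. \<forall>r s. 0 < r \<and> r < s \<longrightarrow> \<psi> x s \<le> C * \<psi> x r)"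

definition G_dec :: "'a measure \<Rightarrow> ('a \<Rightarrow> 'a \<Rightarrow> real) \<Rightarrow> real \<Rightarrow> ('a \<Rightarrow> real \<Rightarrow> real) set" where
  "G_dec M \<rho> p = {\<phi>. positive_radial (space M) \<phi> \<and>
     almost_increasing (space M) (\<lambda>x r. measure M (qball (space M) \<rho> x r) powr (1 / p) * \<phi> x r) \<and>
     almost_decreasing (space M) \<phi>}"

text \<open>The power \<open>x\<^sup>a\<close> on \<open>[0, \<infinity>]\<close>, meant for exponents \<open>a > 0\<close>.\<close>

definition ennpowr :: "ennreal \<Rightarrow> real \<Rightarrow> ennreal" where
  "ennpowr x a = (if x = \<infinity> then \<infinity> else ennreal (enn2real x powr a))"

definition Lp_loc :: "'a measure \<Rightarrow> ('a \<Rightarrow> 'a \<Rightarrow> real) \<Rightarrow> real \<Rightarrow> ('a \<Rightarrow> complex) set" where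
  "Lp_loc M \<rho> p = {f \<in> borel_measurable M. \<forall>x\<in>space M. \<exists>r>0.
     (\<integral>\<^sup>+y\<in>qball (space M) \<rho> x r. ennreal (norm (f y) powr p) \<partial>M) < \<infinity>}"

definition morrey_norm ::
  "'a measure \<Rightarrow> ('a \<Rightarrow> 'a \<Rightarrow> real) \<Rightarrow> real \<Rightarrow> ('a \<Rightarrow> real \<Rightarrow> real) \<Rightarrow> ('a \<Rightarrow> complex) \<Rightarrow> ennreal" where
  "morrey_norm M \<rho> p \<phi> f = (SUP (x, r) \<in> space M \<times> {0<..}.
     ennreal (1 / \<phi> x r) *
     ennpowr ((\<integral>\<^sup>+y\<in>qball (space M) \<rho> x r. ennreal (norm (f y) powr p) \<partial>M)
              / emeasure M (qball (space M) \<rho> x r)) (1 / p))"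

definition morrey_space ::
  "'a measure \<Rightarrow> ('a \<Rightarrow> 'a \<Rightarrow> real) \<Rightarrow> real \<Rightarrow> ('a \<Rightarrow> real \<Rightarrow> real) \<Rightarrow> ('a \<Rightarrow> complex) set" where
  "morrey_space M \<rho> p \<phi> = {f \<in> Lp_loc M \<rho> p. morrey_norm M \<rho> p \<phi> f < \<infinity>}"

text \<open>Here \<open>Inf {} = \<infinity>\<close> covers the functions which are not restrictions of elements of the space.\<close>

definition morrey_norm_on ::
  "'a measure \<Rightarrow> ('a \<Rightarrow> 'a \<Rightarrow> real) \<Rightarrow> real \<Rightarrow> ('a \<Rightarrow> real \<Rightarrow> real) \<Rightarrow> 'a set \<Rightarrow> ('a \<Rightarrow> complex) \<Rightarrow> ennreal" where
  "morrey_norm_on M \<rho> p \<phi> \<Omega> f =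
     Inf {morrey_norm M \<rho> p \<phi> g | g. g \<in> morrey_space M \<rho> p \<phi> \<and> (\<forall>x\<in>\<Omega>. g x = f x)}"

text \<open>
  The norm on \<open>\<Omega>\<close> of a function \<open>F\<close> with values in \<open>[0, \<infinity>]\<close>. If \<open>F\<close> is measurable and finite almost
  everywhere, functions being identified almost everywhere, this is the norm above. If \<open>F\<close> is
  measurable and infinite on a set of positive measure, the infimum is over the empty set.
  The remaining case is a convention: a quasi-metric with measurable balls need not be jointly
  measurable, so the Gagliardo functional below need not be a measurable function; it then gets the
  infimum of the norms of its measurable majorants. (For measurable \<open>F\<close> that infimum is attained at \<open>F\<close>.)
\<close>

definition morrey_norm_on_ennreal ::
  "'a measure \<Rightarrow> ('a \<Rightarrow> 'a \<Rightarrow> real) \<Rightarrow> real \<Rightarrow> ('a \<Rightarrow> real \<Rightarrow> real) \<Rightarrow> 'a set \<Rightarrow> ('a \<Rightarrow> ennreal) \<Rightarrow> ennreal" where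
  "morrey_norm_on_ennreal M \<rho> p \<phi> \<Omega> F =
     (if F \<in> borel_measurable (restrict_space M \<Omega>) \<and> (AE x in M. x \<in> \<Omega> \<longrightarrow> F x < \<infinity>)
      then morrey_norm_on M \<rho> p \<phi> \<Omega> (\<lambda>x. complex_of_real (enn2real (F x)))
      else Inf {morrey_norm_on M \<rho> p \<phi> \<Omega> h | h.
             h \<in> borel_measurable (restrict_space M \<Omega>) \<and>
             (AE x in M. x \<in> \<Omega> \<longrightarrow> F x \<le> ennreal (norm (h x)))})"

definition U_fun :: "'a measure \<Rightarrow> ('a \<Rightarrow> 'a \<Rightarrow> real) \<Rightarrow> 'a \<Rightarrow> 'a \<Rightarrow> real" where
  "U_fun M \<rho> x y = min (measure M (qball (space M) \<rho> x (\<rho> x y))) (measure M (qball (space M) \<rho> y (\<rho> x y)))"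

text \<open>\<open>{\<integral>\<^sub>\<Omega> |f(x) - f(y)|\<^sup>p / (U(x,y) \<rho>(x,y)\<^bsup>sp\<^esup>) d\<mu>(y)}\<^bsup>1/p\<^esup>\<close> as a function of \<open>x\<close>\<close>

definition gagliardo ::
  "'a measure \<Rightarrow> ('a \<Rightarrow> 'a \<Rightarrow> real) \<Rightarrow> real \<Rightarrow> 'a set \<Rightarrow> real \<Rightarrow> ('a \<Rightarrow> complex) \<Rightarrow> 'a \<Rightarrow> ennreal" where
  "gagliardo M \<rho> p \<Omega> s f x =
     ennpowr (\<integral>\<^sup>+y\<in>\<Omega>. (if y = x then 0
        else ennreal (norm (f x - f y) powr p / (U_fun M \<rho> x y * \<rho> x y powr (s * p)))) \<partial>M) (1 / p)"

definition W_dot ::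
  "'a measure \<Rightarrow> ('a \<Rightarrow> 'a \<Rightarrow> real) \<Rightarrow> real \<Rightarrow> ('a \<Rightarrow> real \<Rightarrow> real) \<Rightarrow> 'a set \<Rightarrow> real \<Rightarrow> ('a \<Rightarrow> complex) set" where
  "W_dot M \<rho> p \<phi> \<Omega> s = {f \<in> borel_measurable (restrict_space M \<Omega>).
     morrey_norm_on_ennreal M \<rho> p \<phi> \<Omega> (gagliardo M \<rho> p \<Omega> s f) < \<infinity>}"

definition Holder_b :: "'a set \<Rightarrow> ('a \<Rightarrow> 'a \<Rightarrow> real) \<Rightarrow> real \<Rightarrow> ('a \<Rightarrow> complex) set" where
  "Holder_b X \<rho> \<beta> = {g.
     (\<exists>x\<in>X. \<exists>r>0. {y\<in>X. g y \<noteq> 0} \<subseteq> qball X \<rho> x r) \<and>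
     (\<exists>C. \<forall>x\<in>X. \<forall>y\<in>X. x \<noteq> y \<longrightarrow> norm (g x - g y) / \<rho> x y powr \<beta> \<le> C)}"

definition Holder_b_on :: "'a set \<Rightarrow> ('a \<Rightarrow> 'a \<Rightarrow> real) \<Rightarrow> real \<Rightarrow> 'a set \<Rightarrow> ('a \<Rightarrow> complex) set" where
  "Holder_b_on X \<rho> \<beta> \<Omega> =
     {f. \<exists>g\<in>Holder_b X \<rho> \<beta>. (\<forall>x\<in>\<Omega>. g x = f x) \<and> (\<forall>x\<in>X - \<Omega>. g x = 0)}"

end

theory Submission
  imports Defs
begin

text \<open>
  Write $V(x,r)$ for the measure of the ball $B(x,r)$, let $u$ be \<open>|f|\<^sup>p\<close> on \<open>\<Omega>\<close> and \<open>0\<close> elsewhere, and let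
  \<open>E\<^sub>s(x)\<close> be the integral over $y \in \Omega$ of $|f(x)-f(y)|^p / (U(x,y) \rho(x,y)^{sp})$, the $p$-th
  power of the function whose Morrey norm is to be estimated. The point is that \<open>s E\<^sub>s\<close> is,
  up to constants and as $s$ tends to $0$, bounded by \<open>u\<close> plus averages of \<open>u\<close> with a bounded total
  weight, and bounded below by \<open>u\<close>. Everything is done with $p$-th powers: \<open>morrey_sup\<close> is the supremum over
  balls of the integral divided by $\phi(x,r)^p V(x,r)$, which is countably subadditive on measurable functions whatever $p > 0$ is,
  and the Morrey norms on \<open>\<Omega>\<close> are its $p$-th roots (\<open>morrey_norm_on_eq\<close>,
  \<open>morrey_norm_on_ennreal_eq\<close>).

  Upper bound. Suppose that the seminorm of $f$ is finite for some exponent \<open>s\<^sub>0\<close>. Pairs of distance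
  less than $1$ contribute at most \<open>E\<^sub>s\<^sub>0\<close> when \<open>s \<le> s\<^sub>0\<close>, and the factor $s$ makes this part vanish in the limit.
  Pairs with $2^k \le \rho(x,y) < 2^{k+1}$ contribute at most a constant times $2^{-ksp}$ times the sum of $u(x)$
  and the average of $u$ over $B(x,2^{k+1})$ (\<open>energy_le\<close>). Averaging over balls of a fixed radius $t$ does not
  increase \<open>morrey_sup\<close> by more than a constant factor, uniformly in $t$ (\<open>discretized_average\<close>): over balls of
  radius at least $t$ this is bounded overlap, and over smaller balls the averages are controlled by
  the value of $\phi$ at scale $t$, which $\phi$ at the smaller scale dominates. Since the weights $2^{-ksp}$
  add up to $1/(1-2^{-sp})$, which is of order $1/s$, the bound follows (\<open>limsup_seminorm_le\<close>).

  Lower bound. Weak reverse doubling makes the volumes of large balls grow geometrically along a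
  sequence of radii, so that weak measure density leaves a fixed proportion of the volume to \<open>\<Omega>\<close> in
  each annulus between $t$ and $\Lambda t$ around a fixed centre, for some $\Lambda > 1$
  and all large $t$ (\<open>annuli_of_positive_density\<close>). Outside a large ball $f$ vanishes, and the annuli
  at the radii $\Lambda^k T$ contribute to \<open>E\<^sub>s(x)\<close> at least a constant times
  $|f(x)|^p \sum_k (\Lambda^k T)^{-sp}$, which is of order \<open>|f(x)|\<^sup>p / s\<close> (\<open>energy_ge\<close>). How small $s$ has to be
  depends on the support of $f$, but the constant does not.

  The balls are measurable, but \<open>\<rho>\<close> need not be jointly measurable; hence Fubini's theorem does
  not apply to indicators of pairs of distance less than $t$, and $y \mapsto V(y,\rho(x,y))$ may fail
  to be measurable. Measurability is recovered by two devices: countable nets, which replace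
  averages over balls by comparable countable suprema of multiples of indicator functions, and
  subadditivity of the lower integral when one of the two summands is measurable (\<open>nn_integral_add_le\<close>).
\<close>

section \<open>Powers and lower integrals on the extended half-line\<close>

lemma ennpowr_ennreal: "0 \<le> x \<Longrightarrow> ennpowr (ennreal x) a = ennreal (x powr a)"
  by (simp add: ennpowr_def)

lemma ennpowr_top [simp]: "ennpowr top a = top"
  by (simp add: ennpowr_def)

lemma ennpowr_ennpowr: "ennpowr (ennpowr x a) b = ennpowr x (a * b)"
  by (cases x) (auto simp: ennpowr_ennreal powr_powr)

lemma ennpowr_one [simp]: "ennpowr x 1 = x"
  by (cases x) (auto simp: ennpowr_ennreal)

lemma ennpowr_mono: "0 \<le> a \<Longrightarrow> x \<le> y \<Longrightarrow> ennpowr x a \<le> ennpowr y a"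
  by (cases x; cases y) (auto simp: ennpowr_ennreal powr_mono2 top_unique)

lemma ennpowr_le_iff:
  assumes "0 < p" shows "ennpowr x (1 / p) \<le> y \<longleftrightarrow> x \<le> ennpowr y p"
  using ennpowr_mono[of p "ennpowr x (1 / p)" y] ennpowr_mono[of "1 / p" x "ennpowr y p"] assms
  by (auto simp: ennpowr_ennpowr)

lemma ennpowr_mult:
  assumes "0 < a" shows "ennpowr (ennreal c * x) a = ennpowr (ennreal c) a * ennpowr x a"
proof (cases "c \<le> 0")
  case True
  then show ?thesis using assms by (simp add: ennreal_neg ennpowr_def)
next
  case False
  then show ?thesis
    by (cases x) (auto simp: ennpowr_ennreal powr_mult ennreal_mult[symmetric] ennreal_mult_top)
qed

lemma ennpowr_SUP:
  assumes "0 < p" shows "ennpowr (SUP i\<in>I. g i) (1 / p) = (SUP i\<in>I. ennpowr (g i) (1 / p))"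
proof (rule antisym)
  have "g i \<le> ennpowr (SUP i\<in>I. ennpowr (g i) (1 / p)) p" if "i \<in> I" for i
    using that assms by (subst ennpowr_le_iff[symmetric]) (auto intro: SUP_upper)
  then show "ennpowr (SUP i\<in>I. g i) (1 / p) \<le> (SUP i\<in>I. ennpowr (g i) (1 / p))"
    by (auto simp: ennpowr_le_iff[OF assms] intro: SUP_least)
  show "(SUP i\<in>I. ennpowr (g i) (1 / p)) \<le> ennpowr (SUP i\<in>I. g i) (1 / p)"
    using assms by (intro SUP_least ennpowr_mono SUP_upper) auto
qed

lemma ennpowr_measurable [measurable]: "(\<lambda>x. ennpowr x a) \<in> borel_measurable borel"
  unfolding ennpowr_def by measurable

text \<open>
  The function \<open>g\<close> is arbitrary, and its integral is the supremum of the integrals of simple functions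
  below it. For a finite simple function \<open>\<sigma>\<close> below \<open>g + h\<close>, the truncated difference \<open>\<sigma> - h\<close> is measurable
  and lies below \<open>g\<close>, also where \<open>h\<close> is infinite.
\<close>

lemma nn_integral_add_le:
  assumes h [measurable]: "h \<in> borel_measurable M"
  shows "(\<integral>\<^sup>+x. g x + h x \<partial>M) \<le> (\<integral>\<^sup>+x. g x \<partial>M) + (\<integral>\<^sup>+x. h x \<partial>M)"
  unfolding nn_integral_def_finite[of M "\<lambda>x. g x + h x"]
proof (rule SUP_least, clarsimp)
  fix \<sigma> assume \<sigma>: "simple_function M \<sigma>" "\<sigma> \<le> (\<lambda>x. g x + h x)" "\<forall>x. \<sigma> x < top"
  have [measurable]: "\<sigma> \<in> borel_measurable M" using \<sigma>(1) by (rule borel_measurable_simple_function)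
  have "integral\<^sup>S M \<sigma> = (\<integral>\<^sup>+x. \<sigma> x \<partial>M)" using \<sigma>(1) by (simp add: nn_integral_eq_simple_integral)
  also have "\<dots> \<le> (\<integral>\<^sup>+x. (\<sigma> x - h x) + h x \<partial>M)"
    by (intro nn_integral_mono) (metis add.commute add_diff_self_ennreal linear order_refl diff_add_cancel_ennreal le_add_same_cancel1 zero_le le_add2)
  also have "\<dots> = (\<integral>\<^sup>+x. \<sigma> x - h x \<partial>M) + (\<integral>\<^sup>+x. h x \<partial>M)"
    by (intro nn_integral_add) auto
  also have "(\<integral>\<^sup>+x. \<sigma> x - h x \<partial>M) \<le> (\<integral>\<^sup>+x. g x \<partial>M)"
  proof (intro nn_integral_mono)
    fix x
    have "\<sigma> x \<le> h x + g x" "\<sigma> x \<noteq> top" using \<sigma>(2,3) by (auto simp: le_fun_def ac_simps less_top)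
    then show "\<sigma> x - h x \<le> g x" by (auto simp: ennreal_minus_le_iff)
  qed
  finally show "integral\<^sup>S M \<sigma> \<le> (\<integral>\<^sup>+x. g x \<partial>M) + (\<integral>\<^sup>+x. h x \<partial>M)"
    by (simp add: add_right_mono)
qed

section \<open>Balls, volumes and nets\<close>

text \<open>
  A space of homogeneous type with its constants fixed. The doubling inequality of
  \<open>homogeneous_type\<close> is about the balls of radius \<open>2 * r\<close>, so positivity for all radii is recovered by
  halving.
\<close>

locale doubling_space =
  fixes M :: "'a measure" and \<rho> :: "'a \<Rightarrow> 'a \<Rightarrow> real" and K L :: real
  assumes rho_nonneg: "x \<in> space M \<Longrightarrow> y \<in> space M \<Longrightarrow> 0 \<le> \<rho> x y"
    and rho_eq_0: "x \<in> space M \<Longrightarrow> y \<in> space M \<Longrightarrow> \<rho> x y = 0 \<longleftrightarrow> x = y"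
    and rho_sym: "x \<in> space M \<Longrightarrow> y \<in> space M \<Longrightarrow> \<rho> x y = \<rho> y x"
    and K_ge_1: "1 \<le> K"
    and rho_triangle: "x \<in> space M \<Longrightarrow> y \<in> space M \<Longrightarrow> z \<in> space M \<Longrightarrow> \<rho> x z \<le> K * (\<rho> x y + \<rho> y z)"
    and ball_measurable: "x \<in> space M \<Longrightarrow> 0 < r \<Longrightarrow> qball (space M) \<rho> x r \<in> sets M"
    and L_ge_1: "1 \<le> L"
    and emeasure_ball_pos: "x \<in> space M \<Longrightarrow> 0 < r \<Longrightarrow> 0 < emeasure M (qball (space M) \<rho> x r)"
    and emeasure_ball_finite: "x \<in> space M \<Longrightarrow> 0 < r \<Longrightarrow> emeasure M (qball (space M) \<rho> x r) < \<infinity>"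
    and emeasure_doubling: "x \<in> space M \<Longrightarrow> 0 < r \<Longrightarrow>
      emeasure M (qball (space M) \<rho> x (2 * r)) \<le> ennreal L * emeasure M (qball (space M) \<rho> x r)"

lemma doubling_space_if_homogeneous_type:
  assumes "homogeneous_type M \<rho>"
  obtains K L where "doubling_space M \<rho> K L"
proof -
  from assms obtain K where K: "1 \<le> K" "\<forall>x\<in>space M. \<forall>y\<in>space M. \<forall>z\<in>space M. \<rho> x z \<le> K * (\<rho> x y + \<rho> y z)"
    by (auto simp: homogeneous_type_def quasi_metric_on_def)
  from assms obtain L :: real where L: "1 \<le> L" "\<forall>x\<in>space M. \<forall>r>0.
        0 < emeasure M (qball (space M) \<rho> x (2 * r)) \<and>
        emeasure M (qball (space M) \<rho> x (2 * r)) \<le> ennreal L * emeasure M (qball (space M) \<rho> x r) \<and>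
        ennreal L * emeasure M (qball (space M) \<rho> x r) < \<infinity>"
    by (auto simp: homogeneous_type_def)
  have "doubling_space M \<rho> K L"
  proof
    fix x and r :: real assume x: "x \<in> space M" and r: "0 < r"
    show "0 < emeasure M (qball (space M) \<rho> x r)"
      using L(2)[rule_format, OF x, of "r / 2"] r by simp
    show "emeasure M (qball (space M) \<rho> x r) < \<infinity>"
      using L(2)[rule_format, OF x r] L(1) by (auto simp: ennreal_mult_less_top)
    show "emeasure M (qball (space M) \<rho> x (2 * r)) \<le> ennreal L * emeasure M (qball (space M) \<rho> x r)"
      using L(2) x r by blast
  qed (use assms K L(1) in \<open>auto simp: homogeneous_type_def quasi_metric_on_def\<close>)
  then show ?thesis by (rule that)
qed

context doubling_space
begin

abbreviation "X \<equiv> space M"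
abbreviation "B x r \<equiv> qball (space M) \<rho> x r"
abbreviation "V x r \<equiv> measure M (qball (space M) \<rho> x r)"

lemma ball_empty: "x \<in> X \<Longrightarrow> r \<le> 0 \<Longrightarrow> B x r = {}"
  using rho_nonneg by (force simp: qball_def)

lemma ball_sets [measurable]: "x \<in> X \<Longrightarrow> B x r \<in> sets M"
  using ball_measurable[of x r] ball_empty[of x r] by (cases "0 < r") auto

lemma emeasure_ball: "x \<in> X \<Longrightarrow> 0 < r \<Longrightarrow> emeasure M (B x r) = ennreal (V x r)"
  using emeasure_ball_finite[of x r] by (intro emeasure_eq_ennreal_measure) auto

lemma V_pos: "x \<in> X \<Longrightarrow> 0 < r \<Longrightarrow> 0 < V x r"
  using emeasure_ball_pos[of x r] emeasure_ball[of x r] by simp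

lemma ball_mono: "r \<le> t \<Longrightarrow> B x r \<subseteq> B x t"
  by (auto simp: qball_def)

lemma ball_subset_ball:
  assumes "x \<in> X" "y \<in> X" "\<rho> x y \<le> a"
  shows "B x r \<subseteq> B y (K * (a + r))"
proof
  fix z assume z: "z \<in> B x r"
  have "\<rho> y z \<le> K * (\<rho> y x + \<rho> x z)" using rho_triangle assms z by (auto simp: qball_def)
  also have "\<dots> < K * (a + r)" using z assms K_ge_1 rho_sym[of y x] by (auto simp: qball_def)
  finally show "z \<in> B y (K * (a + r))" using z by (simp add: qball_def)
qed

lemma V_mono:
  assumes "x \<in> X" "y \<in> X" "0 < t" "B x r \<subseteq> B y t"
  shows "V x r \<le> V y t"
  using assms emeasure_ball_finite[of y t] by (intro measure_mono_fmeasurable fmeasurableI) auto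

lemma V_doubling: "x \<in> X \<Longrightarrow> 0 < r \<Longrightarrow> V x (2 ^ n * r) \<le> L ^ n * V x r"
proof (induction n)
  case (Suc n)
  have "ennreal (V x (2 * (2 ^ n * r))) \<le> ennreal (L * V x (2 ^ n * r))"
    using emeasure_doubling[of x "2 ^ n * r"] Suc.prems L_ge_1 by (simp add: emeasure_ball ennreal_mult)
  then have "V x (2 ^ Suc n * r) \<le> L * V x (2 ^ n * r)"
    using L_ge_1 by (simp add: mult.assoc)
  also have "\<dots> \<le> L * (L ^ n * V x r)"
    using Suc L_ge_1 by (intro mult_left_mono) auto
  finally show ?case by (simp add: mult.assoc)
qed simp

text \<open>
  Balls of comparable radii whose centres are not farther apart than a multiple of the radius have
  comparable volumes: one is contained in a dyadic multiple of the other. All constants of the upper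
  and the lower bound that come from the geometry of the space are instances of this.
\<close>

lemma volume_comparison:
  assumes "0 \<le> a" "0 < b"
  shows "\<exists>D>0. \<forall>x\<in>X. \<forall>y\<in>X. \<forall>r>0. \<rho> x y \<le> a * r \<longrightarrow> V x (b * r) \<le> D * V y r"
proof -
  obtain n where n: "K * (a + b) < 2 ^ n"
    using real_arch_pow[of 2 "K * (a + b)"] by auto
  show ?thesis
  proof (intro exI[of _ "L ^ n"] conjI ballI allI impI)
    show "0 < L ^ n" using L_ge_1 by simp
    fix x y and r :: real assume xy: "x \<in> X" "y \<in> X" "0 < r" "\<rho> x y \<le> a * r"
    have "B x (b * r) \<subseteq> B y (K * (a * r + b * r))"
      using xy by (intro ball_subset_ball) auto
    also have "\<dots> \<subseteq> B y (2 ^ n * r)"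
    proof (rule ball_mono)
      have "K * (a + b) * r \<le> 2 ^ n * r" using n xy(3) by (intro mult_right_mono) auto
      then show "K * (a * r + b * r) \<le> 2 ^ n * r" by (simp add: algebra_simps)
    qed
    finally have "V x (b * r) \<le> V y (2 ^ n * r)"
      using xy by (intro V_mono) auto
    also have "\<dots> \<le> L ^ n * V y r" using xy by (intro V_doubling)
    finally show "V x (b * r) \<le> L ^ n * V y r" .
  qed
qed

definition separated :: "real \<Rightarrow> 'a set \<Rightarrow> bool" where
  "separated t D \<longleftrightarrow> D \<subseteq> X \<and> (\<forall>d\<in>D. \<forall>e\<in>D. d \<noteq> e \<longrightarrow> t \<le> \<rho> d e)"

lemma separated_subset: "separated t D \<Longrightarrow> E \<subseteq> D \<Longrightarrow> separated t E"
  unfolding separated_def by (meson subset_eq)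

text \<open>
  Balls of radius \<open>t / (2 * K)\<close> around points of a \<open>t\<close>-separated set are disjoint. Those with
  centre near \<open>y\<close> fit into one ball around \<open>y\<close> of radius comparable to \<open>t\<close>, whose volume is at most a
  constant times the volume of each of them; so there cannot be more of them than this constant. With
  one \<open>N\<close> for all scales, this is bounded overlap of the balls centred in nets.
\<close>

lemma separated_card_bound:
  assumes "0 \<le> c"
  shows "\<exists>N. \<forall>t>0. \<forall>D. separated t D \<longrightarrow>
    (\<forall>y\<in>X. finite {d \<in> D. \<rho> y d \<le> c * t} \<and> card {d \<in> D. \<rho> y d \<le> c * t} \<le> N)"
proof -
  \<comment> \<open>\<open>q * t\<close> is the radius of the disjoint balls, \<open>b * t\<close> that of a ball around \<open>y\<close> containing them.\<close>
  define q where "q = 1 / (2 * K)"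
  have q: "0 < q" "q \<le> 1" using K_ge_1 by (auto simp: q_def field_simps)
  define b where "b = K * (c + 1)"
  have b: "0 < b" using K_ge_1 assms by (simp add: b_def)
  have "0 \<le> c / q" "0 < b / q" using q b assms by auto
  from volume_comparison[OF this] obtain A where A: "0 < A"
    "\<forall>x\<in>X. \<forall>y\<in>X. \<forall>r>0. \<rho> x y \<le> c / q * r \<longrightarrow> V x (b / q * r) \<le> A * V y r"
    by auto
  have bound: "real (card S) \<le> A"
    if t: "0 < t" and S: "separated t S" "y \<in> X" "finite S" "\<And>d. d \<in> S \<Longrightarrow> \<rho> y d \<le> c * t" for t S y
  proof -
    have SX: "S \<subseteq> X" using S(1) by (simp add: separated_def)
    have disj: "disjoint_family_on (\<lambda>d. B d (q * t)) S"
      unfolding disjoint_family_on_def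
    proof (intro ballI impI, rule ccontr)
      fix d e assume de: "d \<in> S" "e \<in> S" "d \<noteq> e" and "B d (q * t) \<inter> B e (q * t) \<noteq> {}"
      then obtain z where z: "z \<in> X" "\<rho> d z < q * t" "\<rho> e z < q * t" by (auto simp: qball_def)
      have "\<rho> d e \<le> K * (\<rho> d z + \<rho> z e)" using de SX z by (intro rho_triangle) auto
      also have "\<dots> < K * (q * t + q * t)"
        using z de SX K_ge_1 rho_sym[of z e] by (intro mult_strict_left_mono add_strict_mono) auto
      also have "\<dots> = t" using K_ge_1 by (simp add: q_def field_simps)
      finally show False using S(1) de by (force simp: separated_def)
    qed
    have "real (card S) * (V y (b * t) / A) = (\<Sum>d\<in>S. V y (b * t) / A)" by simp
    also have "\<dots> \<le> (\<Sum>d\<in>S. V d (q * t))"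
    proof (rule sum_mono)
      fix d assume d: "d \<in> S"
      show "V y (b * t) / A \<le> V d (q * t)"
        using A(2)[rule_format, of y d "q * t"] A(1) d SX S q t by (auto simp: field_simps)
    qed
    also have "\<dots> = measure M (\<Union>d\<in>S. B d (q * t))"
      using SX q t emeasure_ball_finite disj S(3)
      by (intro measure_finite_Union[symmetric]) (auto simp: less_top[symmetric])
    also have "\<dots> \<le> V y (b * t)"
    proof (rule measure_mono_fmeasurable)
      show "(\<Union>d\<in>S. B d (q * t)) \<subseteq> B y (b * t)"
      proof (rule UN_least)
        fix d assume d: "d \<in> S"
        have "B d (q * t) \<subseteq> B y (K * (c * t + q * t))"
          using d SX S by (intro ball_subset_ball) (auto simp: rho_sym subset_eq)
        also have "\<dots> \<subseteq> B y (b * t)"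
          using q t K_ge_1 by (intro ball_mono) (auto simp: b_def distrib_right mult.assoc intro!: mult_left_mono)
        finally show "B d (q * t) \<subseteq> B y (b * t)" .
      qed
      show "(\<Union>d\<in>S. B d (q * t)) \<in> sets M" using SX S(3) by (intro sets.finite_UN) auto
      show "B y (b * t) \<in> fmeasurable M"
        using emeasure_ball_finite[of y "b * t"] S b t by (intro fmeasurableI) auto
    qed
    finally have "real (card S) * (V y (b * t) / A) \<le> A * (V y (b * t) / A)"
      using A(1) by simp
    then show "real (card S) \<le> A"
      using V_pos[of y "b * t"] S b t A(1) by (subst (asm) mult_le_cancel_right) (auto simp: divide_le_0_iff)
  qed
  show ?thesis
  proof (intro exI[of _ "nat \<lfloor>A\<rfloor>"] allI ballI impI conjI)
    fix t D y assume t: "0 < t" and D: "separated t D" "y \<in> X"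
    let ?E = "{d \<in> D. \<rho> y d \<le> c * t}"
    have small: "card S \<le> nat \<lfloor>A\<rfloor>" if "S \<subseteq> ?E" "finite S" for S
    proof -
      have "S \<subseteq> D" using that(1) by blast
      with D(1) have "separated t S" by (rule separated_subset)
      then have "real (card S) \<le> A" using t D(2) that by (intro bound) auto
      then show ?thesis by (rule le_nat_floor)
    qed
    show fin: "finite ?E"
    proof (rule ccontr)
      assume "infinite ?E"
      then obtain S where "S \<subseteq> ?E" "finite S" "card S = Suc (nat \<lfloor>A\<rfloor>)"
        using infinite_arbitrarily_large by blast
      then show False using small[of S] by simp
    qed
    show "card ?E \<le> nat \<lfloor>A\<rfloor>" using small[OF order_refl fin] .
  qed
qed

lemma separated_countable:
  assumes "0 < t" "separated t D" "X \<noteq> {}"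
  shows "countable D"
proof -
  obtain y where y: "y \<in> X" using assms by auto
  have "finite {d \<in> D. \<rho> y d \<le> real n * t}" for n
    using separated_card_bound[of "real n"] assms(1,2) y by (meson of_nat_0_le_iff)
  moreover have "D = (\<Union>n. {d \<in> D. \<rho> y d \<le> real n * t})"
  proof (intro equalityI subsetI)
    fix d assume "d \<in> D"
    moreover obtain n where "\<rho> y d / t \<le> real n" using real_arch_simple by blast
    ultimately show "d \<in> (\<Union>n. {d \<in> D. \<rho> y d \<le> real n * t})"
      using assms(1) by (auto simp: pos_divide_le_eq)
  qed auto
  ultimately show ?thesis
    using countable_UN[of UNIV "\<lambda>n. {d \<in> D. \<rho> y d \<le> real n * t}"] by (simp add: countable_finite)
qed

text \<open>
  A maximal separated set, which exists by Zorn's lemma, is a net: a point at distance at least \<open>t\<close>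
  from all its elements could be added.
\<close>

lemma net_exists:
  assumes "0 < t"
  shows "\<exists>D. separated t D \<and> countable D \<and> (\<forall>x\<in>X. \<exists>d\<in>D. x \<in> B d t)"
proof -
  have "\<exists>D\<in>{D. separated t D}. \<forall>E\<in>{D. separated t D}. D \<subseteq> E \<longrightarrow> E = D"
  proof (rule subset_Zorn')
    fix C assume C: "subset.chain {D. separated t D} C"
    show "\<Union>C \<in> {D. separated t D}"
      unfolding mem_Collect_eq separated_def
    proof (intro conjI ballI impI)
      show "\<Union>C \<subseteq> X" using C by (auto simp: subset_chain_def separated_def)
      fix d e assume "d \<in> \<Union>C" "e \<in> \<Union>C" "d \<noteq> e"
      moreover obtain E where "E \<in> C" "d \<in> E" "e \<in> E"
        using C calculation unfolding subset_chain_def by blast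
      ultimately show "t \<le> \<rho> d e"
        using C by (auto simp: subset_chain_def separated_def)
    qed
  qed
  then obtain D where D: "separated t D" "\<And>E. separated t E \<Longrightarrow> D \<subseteq> E \<Longrightarrow> E = D" by auto
  have "\<exists>d\<in>D. x \<in> B d t" if x: "x \<in> X" for x
  proof (rule ccontr)
    assume "\<not> ?thesis"
    then have far: "\<And>d. d \<in> D \<Longrightarrow> t \<le> \<rho> d x" using x by (force simp: qball_def)
    moreover have "t \<le> \<rho> x d" if d: "d \<in> D" for d
    proof -
      have "d \<in> X" using D(1) d by (auto simp: separated_def)
      then show ?thesis using far[OF d] rho_sym[OF x] by simp
    qed
    ultimately have "separated t (insert x D)"
      using D(1) x by (auto simp: separated_def)
    then have "x \<in> D" using D(2) by blast
    then show False using far[of x] rho_eq_0[of x x] x assms by auto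
  qed
  moreover have "countable D"
    using separated_countable[OF assms D(1)] D(1) by (cases "X = {}") (auto simp: separated_def)
  ultimately show ?thesis using D(1) by blast
qed

text \<open>
  Balls need not be open, so a countable base cannot be quoted. Instead, \<open>\<Omega>\<close> is
  the union of those countably many balls of radius \<open>1 / (n + 1)\<close>, centred in a net of that scale, that are
  contained in \<open>\<Omega>\<close>.
\<close>

lemma qopen_sets:
  assumes "qopen X \<rho> \<Omega>" shows "\<Omega> \<in> sets M"
proof -
  have "\<exists>D. separated (1 / real (Suc n)) D \<and> countable D \<and> (\<forall>x\<in>X. \<exists>d\<in>D. x \<in> B d (1 / real (Suc n)))" for n
    by (rule net_exists) simp
  then obtain D where D: "\<And>n. separated (1 / real (Suc n)) (D n)" "\<And>n. countable (D n)"
      "\<And>n x. x \<in> X \<Longrightarrow> \<exists>d\<in>D n. x \<in> B d (1 / real (Suc n))" by metis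
  let ?I = "\<lambda>n. {d \<in> D n. B d (1 / real (Suc n)) \<subseteq> \<Omega>}"
  have "\<Omega> = (\<Union>n. \<Union>d\<in>?I n. B d (1 / real (Suc n)))"
  proof (intro equalityI subsetI)
    fix x assume x: "x \<in> \<Omega>"
    then obtain r where r: "0 < r" "B x r \<subseteq> \<Omega>" and xX: "x \<in> X"
      using assms unfolding qopen_def by blast
    have "0 < r / (2 * K)" using r K_ge_1 by simp
    then obtain n where n: "1 / real (Suc n) < r / (2 * K)" by (rule nat_approx_posE)
    obtain d where d: "d \<in> D n" "x \<in> B d (1 / real (Suc n))" using D(3)[OF xX] by blast
    have dX: "d \<in> X" using D(1)[of n] d by (auto simp: separated_def)
    have "B d (1 / real (Suc n)) \<subseteq> B x (K * (1 / real (Suc n) + 1 / real (Suc n)))"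
      using d dX xX by (intro ball_subset_ball) (auto simp: qball_def)
    also have "\<dots> \<subseteq> B x r" using n K_ge_1 by (intro ball_mono) (simp add: field_simps)
    finally show "x \<in> (\<Union>n. \<Union>d\<in>?I n. B d (1 / real (Suc n)))" using d r by blast
  qed auto
  also have "\<dots> \<in> sets M"
  proof (intro sets.countable_UN' countableI_type image_subsetI)
    fix n
    show "countable (?I n)" by (rule countable_subset[OF _ D(2)[of n]]) auto
    show "B d (1 / real (Suc n)) \<in> sets M" if "d \<in> ?I n" for d
      using D(1)[of n] that by (intro ball_sets) (auto simp: separated_def)
  qed
  finally show ?thesis .
qed

end

section \<open>The Morrey functional\<close>

text \<open>
  The two ways of changing the argument of \<open>\<phi>\<close>, moving the centre at a fixed radius (nearness) and
  lowering the radius at a fixed centre (almost decreasing), are combined into a single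
  inequality with one constant.
\<close>

locale morrey_weight = doubling_space M \<rho> K L
  for M :: "'a measure" and \<rho> K L +
  fixes p :: real and \<phi> :: "'a \<Rightarrow> real \<Rightarrow> real"
  assumes p_pos: "0 < p"
    and phi_pos: "x \<in> space M \<Longrightarrow> 0 < r \<Longrightarrow> 0 < \<phi> x r"
    and phi_comparison: "\<exists>C>0. \<forall>x\<in>space M. \<forall>y\<in>space M. \<forall>r t.
      0 < r \<longrightarrow> r \<le> t \<longrightarrow> \<rho> x y \<le> t \<longrightarrow> \<phi> x t \<le> C * \<phi> y r"

lemma morrey_weight_if_G_dec:
  assumes "doubling_space M \<rho> K L" "0 < p" "\<phi> \<in> G_dec M \<rho> p" "nearness (space M) \<rho> \<phi>"
  shows "morrey_weight M \<rho> K L p \<phi>"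
proof -
  interpret doubling_space M \<rho> K L by fact
  have pos: "0 < \<phi> x r" if "x \<in> X" "0 < r" for x r
    using assms(3) that by (auto simp: G_dec_def positive_radial_def)
  obtain D where D: "0 < D" "\<And>x r t. x \<in> X \<Longrightarrow> 0 < r \<Longrightarrow> r < t \<Longrightarrow> \<phi> x t \<le> D * \<phi> x r"
    using assms(3) unfolding G_dec_def almost_decreasing_def by blast
  obtain N where N: "0 < N" "\<And>x y r. x \<in> X \<Longrightarrow> y \<in> X \<Longrightarrow> 0 < r \<Longrightarrow> \<rho> x y \<le> r \<Longrightarrow> \<phi> x r / \<phi> y r \<le> N"
    using assms(4) unfolding nearness_def by blast
  have "\<phi> x t \<le> N * max 1 D * \<phi> y r" if xy: "x \<in> X" "y \<in> X" "0 < r" "r \<le> t" "\<rho> x y \<le> t" for x y r t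
  proof -
    have "\<phi> x t \<le> N * \<phi> y t" using N(2)[of x y t] pos[of y t] xy by (auto simp: field_simps)
    also have "\<phi> y t \<le> max 1 D * \<phi> y r"
    proof (cases "r < t")
      case True
      then have "\<phi> y t \<le> D * \<phi> y r" using D(2) xy by blast
      also have "\<dots> \<le> max 1 D * \<phi> y r" using pos[of y r] xy by (intro mult_right_mono) auto
      finally show ?thesis .
    next
      case False
      then have "r = t" using xy by simp
      then show ?thesis using pos[of y r] xy mult_right_mono[of 1 "max 1 D" "\<phi> y r"] by simp
    qed
    finally show ?thesis using N(1) by (simp add: mult.assoc)
  qed
  moreover have "0 < N * max 1 D" using N(1) by simp
  ultimately show ?thesis
    using pos assms(2) by unfold_locales blast+
qed

context morrey_weight
begin

definition W :: "'a \<Rightarrow> real \<Rightarrow> ennreal" where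
  "W x r = ennreal (\<phi> x r powr p * V x r)"

lemma W_pos: "x \<in> X \<Longrightarrow> 0 < r \<Longrightarrow> W x r \<noteq> 0"
  using V_pos[of x r] phi_pos[of x r] by (simp add: W_def)

lemma W_finite: "W x r \<noteq> top"
  by (simp add: W_def)

text \<open>
  The \<open>p\<close>-th power of the Morrey norm, as a functional of the \<open>p\<close>-th power of the function. Unlike
  the norm, it is countably subadditive on measurable functions also for \<open>p < 1\<close>, and it makes sense for functions with
  infinite values.
\<close>

definition morrey_sup :: "('a \<Rightarrow> ennreal) \<Rightarrow> ennreal" where
  "morrey_sup u = (SUP (x, r) \<in> X \<times> {0<..}. (\<integral>\<^sup>+y\<in>B x r. u y \<partial>M) / W x r)"

lemma integral_ball_le:
  assumes "x \<in> X" "0 < r"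
  shows "(\<integral>\<^sup>+y\<in>B x r. u y \<partial>M) \<le> morrey_sup u * W x r"
proof -
  let ?I = "\<integral>\<^sup>+y\<in>B x r. u y \<partial>M"
  have "?I / W x r \<le> morrey_sup u"
    unfolding morrey_sup_def using assms by (intro SUP_upper2[of "(x, r)"]) auto
  then have "?I / W x r * W x r \<le> morrey_sup u * W x r" by (rule mult_right_mono) simp
  then show ?thesis
    using W_pos[OF assms] W_finite[of x r] by (simp add: ennreal_divide_times less_top)
qed

lemma morrey_sup_least:
  assumes "\<And>x r. x \<in> X \<Longrightarrow> 0 < r \<Longrightarrow> (\<integral>\<^sup>+y\<in>B x r. u y \<partial>M) \<le> q * W x r"
  shows "morrey_sup u \<le> q"
  unfolding morrey_sup_def
proof (rule SUP_least, clarsimp)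
  fix x and r :: real assume x: "x \<in> X" "0 < r"
  have "(\<integral>\<^sup>+y\<in>B x r. u y \<partial>M) / W x r \<le> q * W x r / W x r"
    by (rule divide_right_mono_ennreal) (rule assms[OF x])
  then show "(\<integral>\<^sup>+y\<in>B x r. u y \<partial>M) / W x r \<le> q"
    using W_pos[OF x] W_finite[of x r] by (simp add: mult_divide_eq_ennreal)
qed

lemma morrey_sup_mono_AE:
  assumes "AE y in M. u y \<le> v y"
  shows "morrey_sup u \<le> morrey_sup v"
proof (rule morrey_sup_least)
  fix x and r :: real assume x: "x \<in> X" "0 < r"
  have "(\<integral>\<^sup>+y\<in>B x r. u y \<partial>M) \<le> (\<integral>\<^sup>+y\<in>B x r. v y \<partial>M)"
  proof (rule nn_integral_mono_AE)
    show "AE y in M. u y * indicator (B x r) y \<le> v y * indicator (B x r) y"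
      using assms by eventually_elim (simp add: mult_right_mono)
  qed
  also have "\<dots> \<le> morrey_sup v * W x r" using x by (rule integral_ball_le)
  finally show "(\<integral>\<^sup>+y\<in>B x r. u y \<partial>M) \<le> morrey_sup v * W x r" .
qed

lemma morrey_sup_cmult:
  assumes [measurable]: "u \<in> borel_measurable M"
  shows "morrey_sup (\<lambda>x. c * u x) = c * morrey_sup u"
proof -
  have "(\<integral>\<^sup>+y\<in>B x r. c * u y \<partial>M) / W x r = c * ((\<integral>\<^sup>+y\<in>B x r. u y \<partial>M) / W x r)"
    if [simp]: "x \<in> X" for x r
    by (simp add: mult.assoc nn_integral_cmult ennreal_times_divide)
  then show ?thesis
    unfolding morrey_sup_def SUP_mult_left_ennreal by (intro SUP_cong) auto
qed

text \<open>
  Integrals over balls are finite, and countably many balls cover the space. This turns a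
  majorant with values in \<open>[0, \<infinity>]\<close> into a complex-valued one, as needed to pass to \<open>morrey_norm_on\<close>.
\<close>

lemma AE_finite_if_morrey_sup_finite:
  assumes [measurable]: "u \<in> borel_measurable M" and fin: "morrey_sup u \<noteq> top"
  shows "AE x in M. u x \<noteq> top"
proof (cases "X = {}")
  case False
  then obtain z where z: "z \<in> X" by auto
  have "AE y in M. u y * indicator (B z (real (Suc n))) y \<noteq> \<infinity>" for n
  proof (rule nn_integral_PInf_AE)
    have "(\<integral>\<^sup>+y\<in>B z (real (Suc n)). u y \<partial>M) \<le> morrey_sup u * W z (real (Suc n))"
      using z by (intro integral_ball_le) auto
    also have "\<dots> < top" using fin by (auto simp: W_def ennreal_mult_less_top less_top)
    finally show "(\<integral>\<^sup>+y\<in>B z (real (Suc n)). u y \<partial>M) \<noteq> \<infinity>" by auto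
  qed (use z in measurable)
  then have "AE y in M. \<forall>n. u y * indicator (B z (real (Suc n))) y \<noteq> \<infinity>"
    by (simp only: AE_all_countable) blast
  then show ?thesis
  proof (rule AE_mp, intro AE_I2 impI)
    fix y assume y: "y \<in> X" "\<forall>n. u y * indicator (B z (real (Suc n))) y \<noteq> \<infinity>"
    obtain n where "\<rho> z y < real n" using reals_Archimedean2 by blast
    then have "y \<in> B z (real (Suc n))" using y by (simp add: qball_def)
    then show "u y \<noteq> top" using y(2)[rule_format, of n] by simp
  qed
qed (auto intro: AE_I2)

abbreviation pow_norm :: "('a \<Rightarrow> complex) \<Rightarrow> 'a \<Rightarrow> ennreal" where
  "pow_norm f y \<equiv> ennreal (norm (f y) powr p)"

lemma morrey_norm_eq: "morrey_norm M \<rho> p \<phi> f = ennpowr (morrey_sup (pow_norm f)) (1 / p)"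
proof -
  have "ennreal (1 / \<phi> x r) * ennpowr (I / emeasure M (B x r)) (1 / p) = ennpowr (I / W x r) (1 / p)"
    if x: "x \<in> X" "0 < r" for x r I
  proof -
    have pos: "0 < \<phi> x r powr p" "0 < V x r" using phi_pos[OF x] V_pos[OF x] by auto
    have "inverse (W x r) = ennreal (1 / \<phi> x r powr p) * inverse (ennreal (V x r))"
      unfolding W_def using pos by (simp add: inverse_ennreal ennreal_mult[symmetric] field_simps)
    then have "I / W x r = ennreal (1 / \<phi> x r powr p) * (I / emeasure M (B x r))"
      by (simp add: divide_ennreal_def emeasure_ball x ac_simps)
    moreover have "ennpowr (ennreal (1 / \<phi> x r powr p)) (1 / p) = ennreal (1 / \<phi> x r)"
      using phi_pos[OF x] p_pos by (simp add: ennpowr_ennreal powr_divide powr_powr)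
    ultimately show ?thesis using p_pos by (simp add: ennpowr_mult)
  qed
  then show ?thesis
    unfolding morrey_norm_def morrey_sup_def ennpowr_SUP[OF p_pos]
    by (intro SUP_cong) auto
qed

lemma morrey_spaceI:
  assumes [measurable]: "f \<in> borel_measurable M" and fin: "morrey_sup (pow_norm f) \<noteq> top"
  shows "f \<in> morrey_space M \<rho> p \<phi>"
proof -
  have "(\<integral>\<^sup>+y\<in>B x 1. pow_norm f y \<partial>M) < \<infinity>" if x: "x \<in> X" for x
  proof -
    have "(\<integral>\<^sup>+y\<in>B x 1. pow_norm f y \<partial>M) \<le> morrey_sup (pow_norm f) * W x 1"
      using x by (intro integral_ball_le) auto
    also have "\<dots> < \<infinity>" using fin by (auto simp: W_def ennreal_mult_less_top less_top)
    finally show ?thesis .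
  qed
  moreover have "ennpowr (morrey_sup (pow_norm f)) (1 / p) < \<infinity>"
    using fin by (simp add: ennpowr_def)
  ultimately show ?thesis
    by (auto simp: morrey_space_def Lp_loc_def morrey_norm_eq intro!: exI[of _ 1])
qed

text \<open>
  The extension by zero has the least norm of all extensions, and it lies in the Morrey space as soon
  as its norm is finite.
\<close>

lemma morrey_norm_on_eq:
  assumes \<Omega> [measurable]: "\<Omega> \<in> sets M" and f: "f \<in> borel_measurable (restrict_space M \<Omega>)"
  shows "morrey_norm_on M \<rho> p \<phi> \<Omega> f = ennpowr (morrey_sup (\<lambda>x. indicator \<Omega> x * pow_norm f x)) (1 / p)"
    (is "_ = ennpowr (morrey_sup ?u) _")
proof (rule antisym)
  show "ennpowr (morrey_sup ?u) (1 / p) \<le> morrey_norm_on M \<rho> p \<phi> \<Omega> f"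
    unfolding morrey_norm_on_def
  proof (rule Inf_greatest, clarify)
    fix g assume g: "\<forall>x\<in>\<Omega>. g x = f x"
    show "ennpowr (morrey_sup ?u) (1 / p) \<le> morrey_norm M \<rho> p \<phi> g"
      unfolding morrey_norm_eq using g p_pos
      by (intro ennpowr_mono morrey_sup_mono_AE AE_I2) (auto split: split_indicator)
  qed
  show "morrey_norm_on M \<rho> p \<phi> \<Omega> f \<le> ennpowr (morrey_sup ?u) (1 / p)"
  proof (cases "morrey_sup ?u = top")
    case False
    define g where "g x = (if x \<in> \<Omega> then f x else 0)" for x
    have u: "pow_norm g = ?u" using p_pos by (auto simp: g_def fun_eq_iff)
    have "g \<in> borel_measurable M"
      unfolding g_def using f \<Omega> by (simp add: measurable_restrict_space_iff)
    then have "g \<in> morrey_space M \<rho> p \<phi>" using False u by (intro morrey_spaceI) auto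
    then have "morrey_norm_on M \<rho> p \<phi> \<Omega> f \<le> morrey_norm M \<rho> p \<phi> g"
      unfolding morrey_norm_on_def by (intro Inf_lower) (auto simp: g_def)
    then show ?thesis by (simp add: morrey_norm_eq u)
  qed simp
qed

text \<open>
  Both branches of the definition of \<open>morrey_norm_on_ennreal\<close> amount to an infimum over
  measurable majorants: if the function is itself measurable and almost everywhere finite,
  it is the smallest of its majorants. In this form neither bound of the final theorem has to
  distinguish whether the Gagliardo functional is measurable.
\<close>

lemma morrey_norm_on_ennreal_eq:
  assumes \<Omega> [measurable]: "\<Omega> \<in> sets M"
  shows "morrey_norm_on_ennreal M \<rho> p \<phi> \<Omega> (\<lambda>x. ennpowr (J x) (1 / p)) =
    (INF H \<in> {H \<in> borel_measurable M. AE x in M. x \<in> \<Omega> \<longrightarrow> J x \<le> H x}. ennpowr (morrey_sup H) (1 / p))"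
    (is "morrey_norm_on_ennreal M \<rho> p \<phi> \<Omega> ?F = _")
proof (rule antisym)
  have p': "0 \<le> 1 / p" using p_pos by simp
  show "morrey_norm_on_ennreal M \<rho> p \<phi> \<Omega> ?F \<le>
    (INF H \<in> {H \<in> borel_measurable M. AE x in M. x \<in> \<Omega> \<longrightarrow> J x \<le> H x}. ennpowr (morrey_sup H) (1 / p))"
  proof (rule INF_greatest, clarify)
    fix H assume H [measurable]: "H \<in> borel_measurable M" and JH: "AE x in M. x \<in> \<Omega> \<longrightarrow> J x \<le> H x"
    show "morrey_norm_on_ennreal M \<rho> p \<phi> \<Omega> ?F \<le> ennpowr (morrey_sup H) (1 / p)"
    proof (cases "morrey_sup H = top")
      case False
      have fin: "AE x in M. H x \<noteq> top" using H False by (rule AE_finite_if_morrey_sup_finite)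
      define h where "h x = complex_of_real (enn2real (ennpowr (H x) (1 / p)))" for x
      have h [measurable]: "h \<in> borel_measurable M" unfolding h_def by measurable
      have norm_h: "ennreal (norm (h x)) = ennpowr (H x) (1 / p)" if "H x \<noteq> top" for x
        using that by (cases "H x") (auto simp: h_def ennpowr_ennreal)
      have pow_h: "pow_norm h x = H x" if "H x \<noteq> top" for x
        using that p_pos by (cases "H x") (auto simp: h_def ennpowr_ennreal powr_powr)
      show ?thesis
      proof (cases "?F \<in> borel_measurable (restrict_space M \<Omega>) \<and> (AE x in M. x \<in> \<Omega> \<longrightarrow> ?F x < \<infinity>)")
        case True
        define f where "f x = complex_of_real (enn2real (?F x))" for x
        have "(\<lambda>y. complex_of_real (enn2real y)) \<in> borel_measurable borel" by measurable
        from measurable_compose[OF conjunct1[OF True] this]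
        have f: "f \<in> borel_measurable (restrict_space M \<Omega>)" unfolding f_def .
        have "morrey_norm_on_ennreal M \<rho> p \<phi> \<Omega> ?F = morrey_norm_on M \<rho> p \<phi> \<Omega> f"
          unfolding morrey_norm_on_ennreal_def f_def using True by simp
        also have "\<dots> \<le> ennpowr (morrey_sup H) (1 / p)"
          unfolding morrey_norm_on_eq[OF \<Omega> f]
        proof (intro ennpowr_mono p' morrey_sup_mono_AE)
          show "AE x in M. indicator \<Omega> x * pow_norm f x \<le> H x"
            using JH fin
          proof eventually_elim
            case (elim x)
            have "pow_norm f x = J x" if "J x \<noteq> top"
              using that p_pos by (cases "J x") (auto simp: f_def ennpowr_ennreal powr_powr)
            moreover have "J x \<noteq> top" if "x \<in> \<Omega>" using elim that by (auto simp: top_unique)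
            ultimately show ?case using elim by (cases "x \<in> \<Omega>") simp_all
          qed
        qed
        finally show ?thesis .
      next
        case False
        have hr: "h \<in> borel_measurable (restrict_space M \<Omega>)" by (intro measurable_restrict_space1 h)
        have "AE x in M. x \<in> \<Omega> \<longrightarrow> ?F x \<le> ennreal (norm (h x))"
          using JH fin by eventually_elim (auto simp: norm_h intro!: ennpowr_mono p')
        then have "morrey_norm_on_ennreal M \<rho> p \<phi> \<Omega> ?F \<le> morrey_norm_on M \<rho> p \<phi> \<Omega> h"
          unfolding morrey_norm_on_ennreal_def if_not_P[OF False] using hr by (intro Inf_lower) auto
        also have "\<dots> \<le> ennpowr (morrey_sup H) (1 / p)"
          unfolding morrey_norm_on_eq[OF \<Omega> hr]
        proof (intro ennpowr_mono p' morrey_sup_mono_AE)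
          show "AE x in M. indicator \<Omega> x * pow_norm h x \<le> H x"
            using fin by eventually_elim (simp add: pow_h split: split_indicator)
        qed
        finally show ?thesis .
      qed
    qed simp
  qed
next
  have majorant: "(INF H \<in> {H \<in> borel_measurable M. AE x in M. x \<in> \<Omega> \<longrightarrow> J x \<le> H x}. ennpowr (morrey_sup H) (1 / p))
      \<le> morrey_norm_on M \<rho> p \<phi> \<Omega> h"
    if h: "h \<in> borel_measurable (restrict_space M \<Omega>)" and Fh: "AE x in M. x \<in> \<Omega> \<longrightarrow> ?F x \<le> ennreal (norm (h x))" for h
    unfolding morrey_norm_on_eq[OF \<Omega> h]
  proof (rule INF_lower, safe)
    have "(\<lambda>x. if x \<in> \<Omega> then h x else 0) \<in> borel_measurable M"
      using h \<Omega> by (simp add: measurable_restrict_space_iff)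
    then have "(\<lambda>x. indicator \<Omega> x * pow_norm (\<lambda>x. if x \<in> \<Omega> then h x else 0) x) \<in> borel_measurable M"
      by measurable
    also have "(\<lambda>x. indicator \<Omega> x * pow_norm (\<lambda>x. if x \<in> \<Omega> then h x else 0) x) = (\<lambda>x. indicator \<Omega> x * pow_norm h x)"
      by (auto simp: fun_eq_iff split: split_indicator)
    finally show "(\<lambda>x. indicator \<Omega> x * pow_norm h x) \<in> borel_measurable M" .
    show "AE x in M. x \<in> \<Omega> \<longrightarrow> J x \<le> indicator \<Omega> x * pow_norm h x"
      using Fh by eventually_elim (use p_pos in \<open>auto simp: ennpowr_le_iff ennpowr_ennreal\<close>)
  qed
  show "(INF H \<in> {H \<in> borel_measurable M. AE x in M. x \<in> \<Omega> \<longrightarrow> J x \<le> H x}. ennpowr (morrey_sup H) (1 / p))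
      \<le> morrey_norm_on_ennreal M \<rho> p \<phi> \<Omega> ?F"
  proof (cases "?F \<in> borel_measurable (restrict_space M \<Omega>) \<and> (AE x in M. x \<in> \<Omega> \<longrightarrow> ?F x < \<infinity>)")
    case True
    then have F: "?F \<in> borel_measurable (restrict_space M \<Omega>)" and fin: "AE x in M. x \<in> \<Omega> \<longrightarrow> ?F x < \<infinity>"
      by auto
    show ?thesis
      unfolding morrey_norm_on_ennreal_def if_P[OF True]
    proof (rule majorant)
      have "(\<lambda>y. complex_of_real (enn2real y)) \<in> borel_measurable borel" by measurable
      from measurable_compose[OF F this]
      show "(\<lambda>x. complex_of_real (enn2real (?F x))) \<in> borel_measurable (restrict_space M \<Omega>)" .
      show "AE x in M. x \<in> \<Omega> \<longrightarrow> ?F x \<le> ennreal (norm (complex_of_real (enn2real (?F x))))"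
        using fin by eventually_elim (auto simp: less_top)
    qed
  next
    case False
    show ?thesis
      unfolding morrey_norm_on_ennreal_def if_not_P[OF False]
      by (rule Inf_greatest) (auto intro: majorant)
  qed
qed

end

section \<open>Averages over balls of a fixed radius\<close>

context morrey_weight
begin

lemma powr_phi_comparison:
  "\<exists>C>0. \<forall>x\<in>X. \<forall>y\<in>X. \<forall>r t. 0 < r \<longrightarrow> r \<le> t \<longrightarrow> \<rho> x y \<le> t \<longrightarrow> \<phi> x t powr p \<le> C * \<phi> y r powr p"
proof -
  obtain C where C: "0 < C" "\<And>x y r t. x \<in> X \<Longrightarrow> y \<in> X \<Longrightarrow> 0 < r \<Longrightarrow> r \<le> t \<Longrightarrow> \<rho> x y \<le> t \<Longrightarrow> \<phi> x t \<le> C * \<phi> y r"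
    using phi_comparison by blast
  show ?thesis
  proof (intro exI[of _ "C powr p"] conjI ballI allI impI)
    show "0 < C powr p" using C by simp
    fix x y r t assume a: "x \<in> X" "y \<in> X" "0 < r" "r \<le> t" "\<rho> x y \<le> t"
    have "\<phi> x t powr p \<le> (C * \<phi> y r) powr p"
      using C(2)[OF a] phi_pos[of x t] a p_pos by (intro powr_mono2) auto
    then show "\<phi> x t powr p \<le> C powr p * \<phi> y r powr p"
      using C(1) phi_pos[of y r] a by (simp add: powr_mult)
  qed
qed

text \<open>
  The function \<open>T\<close> is a measurable substitute for \<open>x \<mapsto>\<close> average of \<open>u\<close> over \<open>B x t\<close>. For a net \<open>D\<close> of
  scale \<open>t\<close>, it is a multiple of the supremum over \<open>d \<in> D\<close> of the indicator of \<open>B d t\<close> times the integral of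
  \<open>u\<close> over \<open>B d (2 * K * t)\<close> divided by \<open>V d t\<close>; a ball \<open>B x t\<close> with \<open>x \<in> B d t\<close> is contained in
  \<open>B d (2 * K * t)\<close>. That \<open>C\<close> does not depend on \<open>t\<close> is what allows averages at all dyadic scales to be summed.
\<close>

lemma discretized_average:
  "\<exists>C>0. \<forall>u\<in>borel_measurable M. \<forall>t>0. \<exists>T\<in>borel_measurable M.
     (\<forall>x\<in>X. (\<integral>\<^sup>+y\<in>B x t. u y \<partial>M) \<le> ennreal (V x t) * T x) \<and> morrey_sup T \<le> ennreal C * morrey_sup u"
proof -
  have K: "0 < K" using K_ge_1 by simp
  have K4: "1 \<le> 4 * K\<^sup>2" using one_le_power[OF K_ge_1, of 2] by simp
  obtain D1 where D1: "0 < D1" "\<forall>x\<in>X. \<forall>y\<in>X. \<forall>r>0. \<rho> x y \<le> 1 * r \<longrightarrow> V x (1 * r) \<le> D1 * V y r"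
    using volume_comparison[of 1 1] by auto
  obtain D2 where D2: "0 < D2" "\<forall>x\<in>X. \<forall>y\<in>X. \<forall>r>0. \<rho> x y \<le> 0 * r \<longrightarrow> V x (4 * K\<^sup>2 * r) \<le> D2 * V y r"
    using volume_comparison[of 0 "4 * K\<^sup>2"] K by auto
  obtain D3 where D3: "0 < D3" "\<forall>x\<in>X. \<forall>y\<in>X. \<forall>r>0. \<rho> x y \<le> 0 * r \<longrightarrow> V x (2 * K * r) \<le> D3 * V y r"
    using volume_comparison[of 0 "2 * K"] K by auto
  obtain P where P: "0 < P" "\<And>x y r t. x \<in> X \<Longrightarrow> y \<in> X \<Longrightarrow> 0 < r \<Longrightarrow> r \<le> t \<Longrightarrow> \<rho> x y \<le> t \<Longrightarrow>
    \<phi> x t powr p \<le> P * \<phi> y r powr p"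
    using powr_phi_comparison by auto
  obtain N where N: "\<And>t D y. 0 < t \<Longrightarrow> separated t D \<Longrightarrow> y \<in> X \<Longrightarrow>
      finite {d \<in> D. \<rho> y d \<le> 2 * K * t} \<and> card {d \<in> D. \<rho> y d \<le> 2 * K * t} \<le> N"
    using separated_card_bound[of "2 * K"] K by auto
  define q where "q = real N * (P * D2) + P * D3"
  have q: "0 < q" using P D2 D3 by (simp add: q_def add_nonneg_pos)
  show ?thesis
  proof (intro exI[of _ "D1 * q"] conjI ballI allI impI)
    show "0 < D1 * q" using D1 q by simp
    fix u :: "'a \<Rightarrow> ennreal" and t :: real
    assume u [measurable]: "u \<in> borel_measurable M" and t: "0 < t"
    obtain D where D: "separated t D" "countable D" "\<And>x. x \<in> X \<Longrightarrow> \<exists>d\<in>D. x \<in> B d t"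
      using net_exists[OF t] by auto
    have DX: "d \<in> X" if "d \<in> D" for d using D(1) that by (auto simp: separated_def)
    define a where "a d = (\<integral>\<^sup>+y\<in>B d (2 * K * t). u y \<partial>M) / ennreal (V d t)" for d
    define A where "A x = (SUP d\<in>D. a d * indicator (B d t) x)" for x
    have aV: "a d * ennreal (V d t) = (\<integral>\<^sup>+y\<in>B d (2 * K * t). u y \<partial>M)" if "d \<in> D" for d
      unfolding a_def using V_pos[OF DX[OF that] t] by (simp add: ennreal_divide_times)
    have A [measurable]: "A \<in> borel_measurable M"
      unfolding A_def using D(2) DX by (intro borel_measurable_SUP) auto
    have avg: "(\<integral>\<^sup>+y\<in>B x t. u y \<partial>M) \<le> ennreal (V x t) * (ennreal D1 * A x)" if x: "x \<in> X" for x
    proof -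
      obtain d where d: "d \<in> D" "x \<in> B d t" using D(3)[OF x] by blast
      have xd: "\<rho> x d \<le> t" "\<rho> d x \<le> t" using d DX x rho_sym[of x d] by (auto simp: qball_def)
      have "B x t \<subseteq> B d (K * (t + t))"
        using d DX x xd by (intro ball_subset_ball) auto
      then have "(\<integral>\<^sup>+y\<in>B x t. u y \<partial>M) \<le> (\<integral>\<^sup>+y\<in>B d (2 * K * t). u y \<partial>M)"
        by (intro nn_integral_mono) (auto split: split_indicator simp: algebra_simps)
      also have "\<dots> = ennreal (V d t) * a d" using aV[OF d(1)] by (simp add: mult.commute)
      also have "\<dots> \<le> ennreal (D1 * V x t) * A x"
      proof (intro mult_mono ennreal_leI)
        show "V d t \<le> D1 * V x t" using D1(2)[rule_format, of d x t] DX d x t xd by simp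
        show "a d \<le> A x" unfolding A_def using d by (intro SUP_upper2[of d]) auto
      qed auto
      also have "\<dots> = ennreal (V x t) * (ennreal D1 * A x)"
        using D1(1) by (simp add: ennreal_mult ac_simps)
      finally show ?thesis .
    qed
    have "morrey_sup A \<le> ennreal q * morrey_sup u"
    proof (rule morrey_sup_least)
      fix z and r :: real assume z: "z \<in> X" and r: "0 < r"
      show "(\<integral>\<^sup>+y\<in>B z r. A y \<partial>M) \<le> ennreal q * morrey_sup u * W z r"
      proof (cases "t \<le> r")
        case True
        define E where "E = {d \<in> D. \<rho> z d \<le> 2 * K * r}"
        have E: "finite E"
        proof -
          have "0 \<le> 2 * K * r / t" using K r t by simp
          from separated_card_bound[OF this] have "finite {d \<in> D. \<rho> z d \<le> 2 * K * r / t * t}"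
            using t D(1) z by blast
          then show ?thesis using t by (simp add: E_def)
        qed
        \<comment> \<open>On \<open>B z r\<close> the supremum is dominated by a finite sum, which may be integrated term by term.\<close>
        have "(\<integral>\<^sup>+y\<in>B z r. A y \<partial>M) \<le> (\<integral>\<^sup>+y. (\<Sum>d\<in>E. a d * indicator (B d t) y) \<partial>M)"
        proof (rule nn_integral_mono)
          fix y
          show "A y * indicator (B z r) y \<le> (\<Sum>d\<in>E. a d * indicator (B d t) y)"
          proof (cases "y \<in> B z r")
            case y: True
            have "a d * indicator (B d t) y \<le> (\<Sum>d\<in>E. a d * indicator (B d t) y)" if d: "d \<in> D" for d
            proof (cases "y \<in> B d t")
              case yd: True
              have "\<rho> z d \<le> K * (\<rho> z y + \<rho> y d)" using z y yd DX d by (intro rho_triangle) (auto simp: qball_def)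
              also have "\<dots> \<le> K * (r + r)"
                using y yd True K DX[OF d] rho_sym[of y d] by (intro mult_left_mono add_mono) (auto simp: qball_def)
              finally have "d \<in> E" using d by (simp add: E_def)
              then show ?thesis using E by (intro member_le_sum) auto
            qed simp
            then show ?thesis using y by (auto simp: A_def intro: SUP_least)
          qed simp
        qed
        also have "\<dots> = (\<Sum>d\<in>E. a d * ennreal (V d t))"
          using DX t by (subst nn_integral_sum) (auto simp: E_def nn_integral_cmult emeasure_ball intro!: sum.cong)
        also have "\<dots> = (\<Sum>d\<in>E. \<integral>\<^sup>+y\<in>B d (2 * K * t). u y \<partial>M)"
          by (intro sum.cong aV) (auto simp: E_def)
        also have "\<dots> = (\<integral>\<^sup>+y. (\<Sum>d\<in>E. u y * indicator (B d (2 * K * t)) y) \<partial>M)"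
          using DX by (subst nn_integral_sum) (auto simp: E_def)
        also have "\<dots> \<le> (\<integral>\<^sup>+y. of_nat N * (u y * indicator (B z (4 * K\<^sup>2 * r)) y) \<partial>M)"
        proof (rule nn_integral_mono)
          fix y assume y: "y \<in> X"
          \<comment> \<open>Bounded overlap of the enlarged balls; they all lie in a fixed multiple of \<open>B z r\<close>.\<close>
          let ?E = "{d \<in> E. y \<in> B d (2 * K * t)}"
          have "(\<Sum>d\<in>E. u y * indicator (B d (2 * K * t)) y) = (\<Sum>d\<in>?E. u y)"
            using E by (intro sum.mono_neutral_cong_right) (auto split: split_indicator)
          also have "\<dots> = of_nat (card ?E) * u y" by simp
          also have "\<dots> \<le> of_nat N * (u y * indicator (B z (4 * K\<^sup>2 * r)) y)"
          proof (cases "?E = {}")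
            case False
            then obtain d where d: "d \<in> E" "y \<in> B d (2 * K * t)" by auto
            have "\<rho> z y \<le> K * (\<rho> z d + \<rho> d y)" using z y DX d by (intro rho_triangle) (auto simp: E_def)
            also have "\<dots> < K * (2 * K * r + 2 * K * t)"
              using d K by (intro mult_strict_left_mono add_le_less_mono) (auto simp: E_def qball_def)
            also have "\<dots> \<le> K * (2 * K * r + 2 * K * r)"
              using True K by (intro mult_left_mono add_mono) auto
            finally have "y \<in> B z (4 * K\<^sup>2 * r)"
              using y by (simp add: qball_def power2_eq_square algebra_simps)
            moreover have "card ?E \<le> N"
            proof -
              have "card ?E \<le> card {d \<in> D. \<rho> y d \<le> 2 * K * t}"
                using N[OF t D(1) y] DX y by (intro card_mono) (auto simp: E_def qball_def rho_sym)
              then show ?thesis using N[OF t D(1) y] by simp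
            qed
            ultimately show ?thesis by (auto intro!: mult_right_mono)
          next
            case True
            show ?thesis unfolding True by simp
          qed
          finally show "(\<Sum>d\<in>E. u y * indicator (B d (2 * K * t)) y) \<le> of_nat N * (u y * indicator (B z (4 * K\<^sup>2 * r)) y)" .
        qed
        also have "\<dots> = of_nat N * (\<integral>\<^sup>+y\<in>B z (4 * K\<^sup>2 * r). u y \<partial>M)"
          using z by (subst nn_integral_cmult) auto
        also have "\<dots> \<le> of_nat N * (morrey_sup u * W z (4 * K\<^sup>2 * r))"
          using z r K by (intro mult_left_mono integral_ball_le) auto
        also have "W z (4 * K\<^sup>2 * r) \<le> ennreal (P * D2) * W z r"
        proof -
          have "1 * r \<le> 4 * K\<^sup>2 * r" using K4 r by (intro mult_right_mono) auto
          moreover have "\<rho> z z = 0" using z rho_eq_0 by auto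
          ultimately have "\<phi> z (4 * K\<^sup>2 * r) powr p * V z (4 * K\<^sup>2 * r) \<le> (P * \<phi> z r powr p) * (D2 * V z r)"
            using z r K P(1) D2(1) P(2)[of z z r "4 * K\<^sup>2 * r"] D2(2)[rule_format, of z z r]
            by (intro mult_mono) auto
          then show ?thesis
            unfolding W_def using P D2 by (simp add: ennreal_mult[symmetric] ac_simps)
        qed
        also have "of_nat N * (morrey_sup u * (ennreal (P * D2) * W z r)) = ennreal (real N * (P * D2)) * morrey_sup u * W z r"
          using P D2 by (simp add: ennreal_mult ennreal_of_nat_eq_real_of_nat ac_simps)
        also have "\<dots> \<le> ennreal q * morrey_sup u * W z r"
          using P D3 by (intro mult_right_mono ennreal_leI) (auto simp: q_def)
        finally show ?thesis by (simp add: mult_left_mono mult_right_mono)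
      next
        case False
        \<comment> \<open>Pointwise, the Morrey bound for \<open>u\<close> at scale \<open>t\<close> controls each \<open>a d\<close>, and \<open>\<phi>\<close> is almost decreasing.\<close>
        have bound: "A y \<le> ennreal (P * D3 * \<phi> z r powr p) * morrey_sup u" if y: "y \<in> B z r" for y
          unfolding A_def
        proof (rule SUP_least)
          fix d assume d: "d \<in> D"
          show "a d * indicator (B d t) y \<le> ennreal (P * D3 * \<phi> z r powr p) * morrey_sup u"
          proof (cases "y \<in> B d t")
            case yd: True
            have "\<rho> d z \<le> K * (\<rho> d y + \<rho> y z)" using z y yd DX d by (intro rho_triangle) (auto simp: qball_def)
            also have "\<dots> \<le> K * (t + t)"
              using y yd False K z rho_sym[of y z] by (intro mult_left_mono add_mono) (auto simp: qball_def)
            finally have dz: "\<rho> d z \<le> 2 * K * t" by simp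
            have "1 * t \<le> 2 * K * t" using K_ge_1 t by (intro mult_right_mono) auto
            then have rt: "r \<le> 2 * K * t" using False by simp
            have "\<rho> d d = 0" using DX[OF d] rho_eq_0 by auto
            then have "\<phi> d (2 * K * t) powr p * V d (2 * K * t) \<le> (P * \<phi> z r powr p) * (D3 * V d t)"
              using z DX[OF d] r t dz rt P(1) P(2)[of d z r "2 * K * t"] D3(2)[rule_format, of d d t]
              by (intro mult_mono) auto
            then have Wd: "W d (2 * K * t) \<le> ennreal (P * D3 * \<phi> z r powr p) * ennreal (V d t)"
              unfolding W_def using P D3 by (simp add: ennreal_mult[symmetric] ac_simps)
            have "a d \<le> morrey_sup u * W d (2 * K * t) / ennreal (V d t)"
              unfolding a_def using DX[OF d] K t by (intro divide_right_mono_ennreal integral_ball_le) auto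
            also have "\<dots> \<le> morrey_sup u * (ennreal (P * D3 * \<phi> z r powr p) * ennreal (V d t)) / ennreal (V d t)"
              by (intro divide_right_mono_ennreal mult_left_mono Wd) simp
            also have "\<dots> = ennreal (P * D3 * \<phi> z r powr p) * morrey_sup u"
              using V_pos[OF DX[OF d] t]
              by (subst mult.assoc[symmetric], subst mult_divide_eq_ennreal) (auto simp: mult.commute)
            finally show ?thesis using yd by simp
          qed simp
        qed
        have "(\<integral>\<^sup>+y\<in>B z r. A y \<partial>M) \<le> (\<integral>\<^sup>+y\<in>B z r. ennreal (P * D3 * \<phi> z r powr p) * morrey_sup u \<partial>M)"
          by (intro nn_integral_mono) (auto split: split_indicator intro: bound)
        also have "\<dots> = ennreal (P * D3 * \<phi> z r powr p) * morrey_sup u * ennreal (V z r)"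
          using z r by (subst nn_integral_cmult_indicator) (auto simp: emeasure_ball)
        also have "\<dots> = ennreal (P * D3) * morrey_sup u * W z r"
          using P D3 by (simp add: W_def ennreal_mult ac_simps)
        also have "\<dots> \<le> ennreal q * morrey_sup u * W z r"
          using P D2 by (intro mult_right_mono ennreal_leI) (auto simp: q_def)
        finally show ?thesis .
      qed
    qed
    then have "morrey_sup (\<lambda>x. ennreal D1 * A x) \<le> ennreal D1 * (ennreal q * morrey_sup u)"
      by (simp add: morrey_sup_cmult mult_left_mono)
    also have "\<dots> = ennreal (D1 * q) * morrey_sup u" using D1 q by (simp add: ennreal_mult mult.assoc)
    finally show "\<exists>T\<in>borel_measurable M. (\<forall>x\<in>X. (\<integral>\<^sup>+y\<in>B x t. u y \<partial>M) \<le> ennreal (V x t) * T x) \<and>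
        morrey_sup T \<le> ennreal (D1 * q) * morrey_sup u"
      using avg by (intro bexI[of _ "\<lambda>x. ennreal D1 * A x"]) auto
  qed
qed

end

section \<open>Majorants of the energy\<close>

lemma norm_diff_powr_le:
  fixes a b :: "'b::real_normed_vector"
  assumes "0 < p"
  shows "norm (a - b) powr p \<le> 2 powr p * (norm a powr p + norm b powr p)"
proof -
  have "norm (a - b) \<le> 2 * max (norm a) (norm b)"
    using norm_triangle_ineq4[of a b] by linarith
  then have "norm (a - b) powr p \<le> (2 * max (norm a) (norm b)) powr p"
    using assms by (intro powr_mono2) auto
  also have "\<dots> = 2 powr p * max (norm a) (norm b) powr p" by (simp add: powr_mult)
  also have "max (norm a) (norm b) powr p \<le> norm a powr p + norm b powr p"
    by (simp add: max_def)
  finally show ?thesis by simp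
qed

lemma ex_dyadic_scale:
  fixes x :: real
  assumes "1 \<le> x"
  obtains k :: nat where "2 ^ k \<le> x" "x < 2 ^ Suc k"
proof -
  obtain n :: nat where n: "x < 2 ^ n" using real_arch_pow[of 2 x] by auto
  define m where "m = (LEAST n. x < 2 ^ n)"
  have m: "x < 2 ^ m" unfolding m_def using n by (rule LeastI)
  then have "m \<noteq> 0" using assms by (intro notI) simp
  then obtain k where k: "m = Suc k" by (cases m) auto
  have "\<not> x < 2 ^ k" using not_less_Least[of k "\<lambda>n. x < 2 ^ n"] k by (simp add: m_def)
  then show thesis using that[of k] m k by simp
qed

lemma ennreal_average_identity:
  assumes "0 \<le> a" "0 < v"
  shows "ennreal (a / v) * (c * ennreal v + i) = ennreal a * (c + i / ennreal v)"
proof -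
  have "ennreal (a / v) * ennreal v = ennreal a" using assms by (simp flip: ennreal_mult)
  moreover have "ennreal (a / v) * i = ennreal a * (i / ennreal v)"
    using assms by (simp add: divide_ennreal[symmetric] divide_ennreal_def ac_simps)
  moreover have "ennreal (a / v) * (c * ennreal v) = c * (ennreal (a / v) * ennreal v)"
    by (rule mult.left_commute)
  ultimately show ?thesis by (simp only: distrib_left mult.commute[of c])
qed

context morrey_weight
begin

definition energy :: "'a set \<Rightarrow> real \<Rightarrow> ('a \<Rightarrow> complex) \<Rightarrow> 'a \<Rightarrow> ennreal" where
  "energy \<Omega> s f x = (\<integral>\<^sup>+y\<in>\<Omega>. (if y = x then 0
     else ennreal (norm (f x - f y) powr p / (U_fun M \<rho> x y * \<rho> x y powr (s * p)))) \<partial>M)"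

lemma gagliardo_eq: "gagliardo M \<rho> p \<Omega> s f = (\<lambda>x. ennpowr (energy \<Omega> s f x) (1 / p))"
  by (simp add: gagliardo_def energy_def fun_eq_iff)

abbreviation restricted_pow :: "'a set \<Rightarrow> ('a \<Rightarrow> complex) \<Rightarrow> 'a \<Rightarrow> ennreal" where
  "restricted_pow \<Omega> f x \<equiv> indicator \<Omega> x * pow_norm f x"

lemma restricted_pow_measurable:
  assumes \<Omega>: "\<Omega> \<in> sets M" and f: "f \<in> borel_measurable (restrict_space M \<Omega>)"
  shows "restricted_pow \<Omega> f \<in> borel_measurable M"
proof -
  have [measurable]: "(\<lambda>x. if x \<in> \<Omega> then f x else 0) \<in> borel_measurable M"
    using f \<Omega> by (simp add: measurable_restrict_space_iff)
  have "(\<lambda>x. ennreal (norm (if x \<in> \<Omega> then f x else 0) powr p)) \<in> borel_measurable M"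
    by measurable
  also have "(\<lambda>x. ennreal (norm (if x \<in> \<Omega> then f x else 0) powr p)) = restricted_pow \<Omega> f"
    using p_pos by (auto simp: fun_eq_iff split: split_indicator)
  finally show ?thesis .
qed

text \<open>
  Both volumes in \<open>U\<close> are comparable to the volume of a ball around \<open>x\<close>. The factor \<open>2\<close> in the bound on
  \<open>t\<close> leaves room for a dyadic radius just above \<open>\<rho> x y\<close>.
\<close>

lemma U_lower:
  obtains D where "0 < D" "\<And>x y t. x \<in> X \<Longrightarrow> y \<in> X \<Longrightarrow> x \<noteq> y \<Longrightarrow> t \<le> 2 * \<rho> x y \<Longrightarrow> 0 < t \<Longrightarrow> V x t \<le> D * U_fun M \<rho> x y"
proof -
  obtain D where D: "0 < D" "\<forall>x\<in>X. \<forall>y\<in>X. \<forall>r>0. \<rho> x y \<le> 1 * r \<longrightarrow> V x (2 * r) \<le> D * V y r"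
    using volume_comparison[of 1 2] by auto
  show thesis
  proof (rule that[OF D(1)])
    fix x y t assume xy: "x \<in> X" "y \<in> X" "x \<noteq> y" "t \<le> 2 * \<rho> x y" "0 < t"
    have r: "0 < \<rho> x y" using xy by linarith
    have "\<rho> x x = 0" using xy rho_eq_0[of x x] by simp
    then have "V x (2 * \<rho> x y) \<le> D * U_fun M \<rho> x y"
      using D(2)[rule_format, of x x "\<rho> x y"] D(2)[rule_format, of x y "\<rho> x y"] xy r
      by (simp add: U_fun_def min_def)
    moreover have "V x t \<le> V x (2 * \<rho> x y)"
      using xy r by (intro V_mono ball_mono) auto
    ultimately show "V x t \<le> D * U_fun M \<rho> x y" by simp
  qed
qed

text \<open>
  Pairs of distance less than \<open>1\<close> are estimated by the energy of the larger exponent \<open>s\<^sub>0\<close>. The other ones are sorted by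
  the dyadic scale of their distance; there \<open>|f x - f y|\<^sup>p\<close> is split into its two parts, the
  kernel is constant up to a factor, and integration in \<open>y\<close> gives \<open>u x\<close> and an average of \<open>u\<close>.
\<close>

lemma energy_le:
  "\<exists>C>0. \<forall>\<Omega>\<in>sets M. \<forall>f\<in>borel_measurable (restrict_space M \<Omega>). \<forall>s s\<^sub>0. 0 < s \<longrightarrow> s \<le> s\<^sub>0 \<longrightarrow> (\<forall>x\<in>\<Omega>.
     energy \<Omega> s f x \<le> energy \<Omega> s\<^sub>0 f x + (\<Sum>k. ennreal (C * (2 powr - (s * p)) ^ k) *
       (restricted_pow \<Omega> f x + (\<integral>\<^sup>+y\<in>B x (2 ^ Suc k). restricted_pow \<Omega> f y \<partial>M) / ennreal (V x (2 ^ Suc k)))))"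
proof -
  obtain D where D: "0 < D" "\<And>x y t. x \<in> X \<Longrightarrow> y \<in> X \<Longrightarrow> x \<noteq> y \<Longrightarrow> t \<le> 2 * \<rho> x y \<Longrightarrow> 0 < t \<Longrightarrow> V x t \<le> D * U_fun M \<rho> x y"
    by (rule U_lower) blast
  define C where "C = 2 powr p * D"
  have C: "0 < C" using D by (simp add: C_def)
  show ?thesis
  proof (intro exI[of _ C] conjI ballI allI impI C)
    fix \<Omega> x and f :: "'a \<Rightarrow> complex" and s s\<^sub>0 :: real
    assume \<Omega> [measurable]: "\<Omega> \<in> sets M" and f: "f \<in> borel_measurable (restrict_space M \<Omega>)"
      and s: "0 < s" "s \<le> s\<^sub>0" and x: "x \<in> \<Omega>"
    let ?\<theta> = "2 powr - (s * p)"
    let ?u = "restricted_pow \<Omega> f"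
    let ?R = "\<lambda>k. (2::real) ^ Suc k"
    define F where "F s y = (if y = x then 0
      else ennreal (norm (f x - f y) powr p / (U_fun M \<rho> x y * \<rho> x y powr (s * p)))) * indicator \<Omega> y" for s y
    define G where "G k y = ennreal (C * ?\<theta> ^ k / V x (?R k)) * ((?u x + ?u y) * indicator (B x (?R k)) y)" for k y
    have xX: "x \<in> X" using x \<Omega> sets.sets_into_space by blast
    have u [measurable]: "?u \<in> borel_measurable M" using \<Omega> f by (rule restricted_pow_measurable)
    have G [measurable]: "G k \<in> borel_measurable M" for k unfolding G_def using xX by measurable
    have "energy \<Omega> s f x = (\<integral>\<^sup>+y. F s y \<partial>M)" by (simp add: energy_def F_def)
    also have "\<dots> \<le> (\<integral>\<^sup>+y. F s\<^sub>0 y + (\<Sum>k. G k y) \<partial>M)"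
    proof (rule nn_integral_mono)
      fix y assume yX: "y \<in> X"
      show "F s y \<le> F s\<^sub>0 y + (\<Sum>k. G k y)"
      proof (cases "y \<in> \<Omega> \<and> y \<noteq> x")
        case True
        then have y: "y \<in> \<Omega>" "y \<noteq> x" by auto
        have rho: "0 < \<rho> x y" using rho_nonneg[OF xX yX] rho_eq_0[OF xX yX] y by (auto simp: less_le)
        have Upos: "0 < U_fun M \<rho> x y"
          using V_pos[OF xX rho] V_pos[OF yX rho] by (simp add: U_fun_def)
        show ?thesis
        proof (cases "\<rho> x y < 1")
          case True
          have "\<rho> x y powr (s\<^sub>0 * p) \<le> \<rho> x y powr (s * p)"
            using rho True s p_pos by (intro powr_mono') auto
          then have "F s y \<le> F s\<^sub>0 y"
            unfolding F_def using y Upos rho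
            by (auto intro!: ennreal_leI divide_left_mono mult_left_mono)
          then show ?thesis by (simp add: add_increasing2)
        next
          case False
          then obtain k where k: "2 ^ k \<le> \<rho> x y" "\<rho> x y < ?R k"
            using ex_dyadic_scale[of "\<rho> x y"] by auto
          have V: "0 < V x (?R k)" using xX by (intro V_pos) auto
          have "?\<theta> ^ k = inverse ((2 ^ k) powr (s * p))"
            by (simp add: powr_minus powr_power power_inverse powr_powr powr_realpow[symmetric] mult.commute)
          moreover have "(2 ^ k) powr (s * p) \<le> \<rho> x y powr (s * p)"
            using k s p_pos by (intro powr_mono2) auto
          ultimately have "1 / \<rho> x y powr (s * p) \<le> ?\<theta> ^ k"
            using rho by (simp add: inverse_eq_divide divide_left_mono)
          moreover have "1 / U_fun M \<rho> x y \<le> D / V x (?R k)"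
            using D(2)[of x y "?R k"] xX yX y k V Upos by (simp add: field_simps)
          moreover have "norm (f x - f y) powr p \<le> 2 powr p * (norm (f x) powr p + norm (f y) powr p)"
            by (rule norm_diff_powr_le[OF p_pos])
          ultimately have "norm (f x - f y) powr p * (1 / U_fun M \<rho> x y) * (1 / \<rho> x y powr (s * p))
            \<le> 2 powr p * (norm (f x) powr p + norm (f y) powr p) * (D / V x (?R k)) * ?\<theta> ^ k"
            using D V Upos by (intro mult_mono) auto
          then have "F s y \<le> ennreal (C * ?\<theta> ^ k / V x (?R k) * (norm (f x) powr p + norm (f y) powr p))"
            unfolding F_def C_def using y by (auto intro!: ennreal_leI simp: ac_simps)
          also have "\<dots> = ennreal (C * ?\<theta> ^ k / V x (?R k)) * (pow_norm f x + pow_norm f y)"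
            using C V by (subst ennreal_mult) auto
          also have "\<dots> = G k y"
            unfolding G_def using y x k(2) yX by (simp add: qball_def)
          also have "\<dots> \<le> (\<Sum>k. G k y)"
            using sum_le_suminf[of "\<lambda>k. G k y" "{k}"] by simp
          finally show ?thesis by (simp add: add_increasing)
        qed
      qed (auto simp: F_def)
    qed
    also have "\<dots> \<le> (\<integral>\<^sup>+y. F s\<^sub>0 y \<partial>M) + (\<integral>\<^sup>+y. (\<Sum>k. G k y) \<partial>M)"
      by (rule nn_integral_add_le) measurable
    also have "(\<integral>\<^sup>+y. F s\<^sub>0 y \<partial>M) = energy \<Omega> s\<^sub>0 f x" by (simp add: energy_def F_def)
    also have "(\<integral>\<^sup>+y. (\<Sum>k. G k y) \<partial>M) = (\<Sum>k. \<integral>\<^sup>+y. G k y \<partial>M)"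
      by (rule nn_integral_suminf) measurable
    also have "\<dots> = (\<Sum>k. ennreal (C * ?\<theta> ^ k) * (?u x + (\<integral>\<^sup>+y\<in>B x (?R k). ?u y \<partial>M) / ennreal (V x (?R k))))"
    proof (rule suminf_cong)
      fix k
      have R: "0 < ?R k" by simp
      have "(\<integral>\<^sup>+y. G k y \<partial>M) = ennreal (C * ?\<theta> ^ k / V x (?R k)) *
          (\<integral>\<^sup>+y. ?u x * indicator (B x (?R k)) y + ?u y * indicator (B x (?R k)) y \<partial>M)"
        unfolding G_def distrib_right using xX by (intro nn_integral_cmult) measurable
      also have "(\<integral>\<^sup>+y. ?u x * indicator (B x (?R k)) y + ?u y * indicator (B x (?R k)) y \<partial>M) =
          ?u x * ennreal (V x (?R k)) + (\<integral>\<^sup>+y\<in>B x (?R k). ?u y \<partial>M)"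
        using xX by (subst nn_integral_add) (auto simp: nn_integral_cmult_indicator emeasure_ball[OF xX R] simp del: power_Suc)
      also have "ennreal (C * ?\<theta> ^ k / V x (?R k)) * \<dots> =
          ennreal (C * ?\<theta> ^ k) * (?u x + (\<integral>\<^sup>+y\<in>B x (?R k). ?u y \<partial>M) / ennreal (V x (?R k)))"
        using C V_pos[OF xX R] by (intro ennreal_average_identity) auto
      finally show "(\<integral>\<^sup>+y. G k y \<partial>M) = ennreal (C * ?\<theta> ^ k) *
        (?u x + (\<integral>\<^sup>+y\<in>B x (?R k). ?u y \<partial>M) / ennreal (V x (?R k)))" .
    qed
    finally show "energy \<Omega> s f x \<le> energy \<Omega> s\<^sub>0 f x + (\<Sum>k. ennreal (C * ?\<theta> ^ k) *
      (?u x + (\<integral>\<^sup>+y\<in>B x (?R k). ?u y \<partial>M) / ennreal (V x (?R k))))" .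
  qed
qed

text \<open>
  The averages in \<open>energy_le\<close> are replaced by the measurable functions of \<open>discretized_average\<close>, whose \<open>morrey_sup\<close>
  is at most a multiple of that of \<open>u\<close> for every dyadic scale. So only the sum of the geometric
  series of weights enters, which is of order \<open>1 / s\<close>.
\<close>

lemma energy_majorant:
  "\<exists>C>0. \<forall>\<Omega>\<in>sets M. \<forall>f\<in>borel_measurable (restrict_space M \<Omega>). \<forall>s\<^sub>0. \<forall>H\<^sub>0\<in>borel_measurable M.
     (AE x in M. x \<in> \<Omega> \<longrightarrow> energy \<Omega> s\<^sub>0 f x \<le> H\<^sub>0 x) \<longrightarrow> (\<forall>s. 0 < s \<longrightarrow> s \<le> s\<^sub>0 \<longrightarrow>
       (\<exists>H\<in>borel_measurable M. (AE x in M. x \<in> \<Omega> \<longrightarrow> energy \<Omega> s f x \<le> H x) \<and>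
          morrey_sup H \<le> morrey_sup H\<^sub>0 + ennreal (C / (1 - 2 powr - (s * p))) * morrey_sup (restricted_pow \<Omega> f)))"
proof -
  obtain C1 where C1: "0 < C1" "\<forall>\<Omega>\<in>sets M. \<forall>f\<in>borel_measurable (restrict_space M \<Omega>). \<forall>s s\<^sub>0. 0 < s \<longrightarrow> s \<le> s\<^sub>0 \<longrightarrow> (\<forall>x\<in>\<Omega>.
     energy \<Omega> s f x \<le> energy \<Omega> s\<^sub>0 f x + (\<Sum>k. ennreal (C1 * (2 powr - (s * p)) ^ k) *
       (restricted_pow \<Omega> f x + (\<integral>\<^sup>+y\<in>B x (2 ^ Suc k). restricted_pow \<Omega> f y \<partial>M) / ennreal (V x (2 ^ Suc k)))))"
    using energy_le by blast
  obtain C2 where C2: "0 < C2" "\<And>u t. u \<in> borel_measurable M \<Longrightarrow> 0 < t \<Longrightarrow> \<exists>T\<in>borel_measurable M.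
     (\<forall>x\<in>X. (\<integral>\<^sup>+y\<in>B x t. u y \<partial>M) \<le> ennreal (V x t) * T x) \<and> morrey_sup T \<le> ennreal C2 * morrey_sup u"
    using discretized_average by blast
  define C where "C = C1 * (1 + C2)"
  have C: "0 < C" using C1 C2 by (simp add: C_def)
  show ?thesis
  proof (intro exI[of _ C] conjI C ballI allI impI)
    fix \<Omega> H\<^sub>0 and f :: "'a \<Rightarrow> complex" and s\<^sub>0 s :: real
    assume \<Omega> [measurable]: "\<Omega> \<in> sets M" and f: "f \<in> borel_measurable (restrict_space M \<Omega>)"
      and H0 [measurable]: "H\<^sub>0 \<in> borel_measurable M"
      and EH0: "AE x in M. x \<in> \<Omega> \<longrightarrow> energy \<Omega> s\<^sub>0 f x \<le> H\<^sub>0 x"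
      and s: "0 < s" "s \<le> s\<^sub>0"
    let ?u = "restricted_pow \<Omega> f"
    let ?R = "\<lambda>k. (2::real) ^ Suc k"
    define \<theta> where "\<theta> = 2 powr - (s * p)"
    have \<theta>: "0 < \<theta>" "\<theta> < 1" using s p_pos by (auto simp: \<theta>_def powr_less_one)
    have u [measurable]: "?u \<in> borel_measurable M" using \<Omega> f by (rule restricted_pow_measurable)
    have "\<forall>k. \<exists>T. T \<in> borel_measurable M \<and>
        (\<forall>x\<in>X. (\<integral>\<^sup>+y\<in>B x (?R k). ?u y \<partial>M) \<le> ennreal (V x (?R k)) * T x) \<and>
        morrey_sup T \<le> ennreal C2 * morrey_sup ?u"
      using C2(2)[OF u, of "?R _"] unfolding Bex_def by simp
    from choice[OF this] obtain T where T_all: "\<forall>k. T k \<in> borel_measurable M \<and>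
        (\<forall>x\<in>X. (\<integral>\<^sup>+y\<in>B x (?R k). ?u y \<partial>M) \<le> ennreal (V x (?R k)) * T k x) \<and>
        morrey_sup (T k) \<le> ennreal C2 * morrey_sup ?u" ..
    have T [measurable]: "T k \<in> borel_measurable M" for k using T_all by simp
    have avg: "(\<integral>\<^sup>+y\<in>B x (?R k). ?u y \<partial>M) \<le> ennreal (V x (?R k)) * T k x" if "x \<in> X" for k x
      using T_all that by blast
    have supT: "morrey_sup (T k) \<le> ennreal C2 * morrey_sup ?u" for k using T_all by blast
    define H where "H x = H\<^sub>0 x + (\<Sum>k. ennreal (C1 * \<theta> ^ k) * (?u x + T k x))" for x
    have H [measurable]: "H \<in> borel_measurable M" unfolding H_def by measurable
    show "\<exists>H\<in>borel_measurable M. (AE x in M. x \<in> \<Omega> \<longrightarrow> energy \<Omega> s f x \<le> H x) \<and>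
          morrey_sup H \<le> morrey_sup H\<^sub>0 + ennreal (C / (1 - 2 powr - (s * p))) * morrey_sup ?u"
    proof (intro bexI[OF _ H] conjI)
      show "AE x in M. x \<in> \<Omega> \<longrightarrow> energy \<Omega> s f x \<le> H x"
        using EH0
      proof eventually_elim
        case (elim x)
        show ?case
        proof
          assume x: "x \<in> \<Omega>"
          then have xX: "x \<in> X" using \<Omega> sets.sets_into_space by blast
          have "energy \<Omega> s f x \<le> energy \<Omega> s\<^sub>0 f x + (\<Sum>k. ennreal (C1 * \<theta> ^ k) *
             (?u x + (\<integral>\<^sup>+y\<in>B x (?R k). ?u y \<partial>M) / ennreal (V x (?R k))))"
            using C1(2) \<Omega> f s x unfolding \<theta>_def by blast
          also have "\<dots> \<le> H x"
            unfolding H_def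
          proof (intro add_mono suminf_le mult_left_mono summableI)
            show "energy \<Omega> s\<^sub>0 f x \<le> H\<^sub>0 x" using elim x by blast
            fix k
            have V: "0 < V x (?R k)" using xX by (intro V_pos) auto
            have "(\<integral>\<^sup>+y\<in>B x (?R k). ?u y \<partial>M) / ennreal (V x (?R k)) \<le> ennreal (V x (?R k)) * T k x / ennreal (V x (?R k))"
              by (intro divide_right_mono_ennreal avg xX)
            also have "\<dots> = T k x"
              using V by (subst mult.commute, subst mult_divide_eq_ennreal) auto
            finally show "(\<integral>\<^sup>+y\<in>B x (?R k). ?u y \<partial>M) / ennreal (V x (?R k)) \<le> T k x" .
          qed auto
          finally show "energy \<Omega> s f x \<le> H x" .
        qed
      qed
      show "morrey_sup H \<le> morrey_sup H\<^sub>0 + ennreal (C / (1 - 2 powr - (s * p))) * morrey_sup ?u"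
      proof (rule morrey_sup_least)
        fix z and r :: real assume z [measurable]: "z \<in> X" and r: "0 < r"
        have split: "H y * indicator (B z r) y = H\<^sub>0 y * indicator (B z r) y +
            (\<Sum>k. ennreal (C1 * \<theta> ^ k) * (?u y * indicator (B z r) y + T k y * indicator (B z r) y))" for y
        proof -
          have "H y * indicator (B z r) y = H\<^sub>0 y * indicator (B z r) y +
              (\<Sum>k. ennreal (C1 * \<theta> ^ k) * (?u y + T k y) * indicator (B z r) y)"
            unfolding H_def distrib_right ennreal_suminf_multc ..
          then show ?thesis by (simp only: distrib_right mult.assoc)
        qed
        let ?S = "\<lambda>k y. ennreal (C1 * \<theta> ^ k) * (?u y * indicator (B z r) y + T k y * indicator (B z r) y)"
        have "(\<integral>\<^sup>+y\<in>B z r. H y \<partial>M) = (\<integral>\<^sup>+y. H\<^sub>0 y * indicator (B z r) y + (\<Sum>k. ?S k y) \<partial>M)"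
          by (simp only: split)
        also have "\<dots> = (\<integral>\<^sup>+y\<in>B z r. H\<^sub>0 y \<partial>M) + (\<integral>\<^sup>+y. (\<Sum>k. ?S k y) \<partial>M)"
          by (rule nn_integral_add) measurable
        also have "(\<integral>\<^sup>+y. (\<Sum>k. ?S k y) \<partial>M) = (\<Sum>k. \<integral>\<^sup>+y. ?S k y \<partial>M)"
          by (rule nn_integral_suminf) measurable
        also have "(\<lambda>k. \<integral>\<^sup>+y. ?S k y \<partial>M) = (\<lambda>k. ennreal (C1 * \<theta> ^ k) * ((\<integral>\<^sup>+y\<in>B z r. ?u y \<partial>M) + (\<integral>\<^sup>+y\<in>B z r. T k y \<partial>M)))"
        proof
          fix k
          have "(\<integral>\<^sup>+y. ?S k y \<partial>M) = ennreal (C1 * \<theta> ^ k) * (\<integral>\<^sup>+y. ?u y * indicator (B z r) y + T k y * indicator (B z r) y \<partial>M)"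
            by (rule nn_integral_cmult) measurable
          also have "(\<integral>\<^sup>+y. ?u y * indicator (B z r) y + T k y * indicator (B z r) y \<partial>M) =
              (\<integral>\<^sup>+y\<in>B z r. ?u y \<partial>M) + (\<integral>\<^sup>+y\<in>B z r. T k y \<partial>M)"
            by (rule nn_integral_add) measurable
          finally show "(\<integral>\<^sup>+y. ?S k y \<partial>M) = ennreal (C1 * \<theta> ^ k) * ((\<integral>\<^sup>+y\<in>B z r. ?u y \<partial>M) + (\<integral>\<^sup>+y\<in>B z r. T k y \<partial>M))" .
        qed
        also have "(\<integral>\<^sup>+y\<in>B z r. H\<^sub>0 y \<partial>M) + (\<Sum>k. ennreal (C1 * \<theta> ^ k) * ((\<integral>\<^sup>+y\<in>B z r. ?u y \<partial>M) + (\<integral>\<^sup>+y\<in>B z r. T k y \<partial>M)))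
            \<le> morrey_sup H\<^sub>0 * W z r + (\<Sum>k. ennreal (C1 * \<theta> ^ k) * (ennreal (1 + C2) * morrey_sup ?u * W z r))"
        proof (intro add_mono suminf_le mult_left_mono summableI integral_ball_le z r)
          fix k
          have "(\<integral>\<^sup>+y\<in>B z r. ?u y \<partial>M) + (\<integral>\<^sup>+y\<in>B z r. T k y \<partial>M) \<le> morrey_sup ?u * W z r + ennreal C2 * morrey_sup ?u * W z r"
            using integral_ball_le[OF z r, of ?u] order_trans[OF integral_ball_le[OF z r, of "T k"] mult_right_mono[OF supT[of k]]]
            by (intro add_mono) auto
          also have "\<dots> = ennreal (1 + C2) * morrey_sup ?u * W z r"
            using C2(1) by (simp add: ennreal_plus distrib_right)
          finally show "(\<integral>\<^sup>+y\<in>B z r. ?u y \<partial>M) + (\<integral>\<^sup>+y\<in>B z r. T k y \<partial>M) \<le> ennreal (1 + C2) * morrey_sup ?u * W z r" .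
        qed auto
        also have "(\<Sum>k. ennreal (C1 * \<theta> ^ k) * (ennreal (1 + C2) * morrey_sup ?u * W z r)) =
            (\<Sum>k. ennreal (C1 * \<theta> ^ k)) * (ennreal (1 + C2) * morrey_sup ?u * W z r)"
          by (rule ennreal_suminf_multc)
        also have "(\<Sum>k. ennreal (C1 * \<theta> ^ k)) = ennreal (C1 / (1 - \<theta>))"
          using C1(1) \<theta> by (subst suminf_ennreal2) (auto simp: suminf_mult suminf_geometric summable_mult summable_geometric)
        also have "ennreal (C1 / (1 - \<theta>)) * (ennreal (1 + C2) * morrey_sup ?u * W z r) = ennreal (C / (1 - \<theta>)) * morrey_sup ?u * W z r"
        proof -
          have "ennreal (C1 / (1 - \<theta>)) * ennreal (1 + C2) = ennreal (C / (1 - \<theta>))"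
            using C1(1) C2(1) \<theta> by (subst ennreal_mult[symmetric]) (auto simp: C_def)
          then show ?thesis by (simp flip: mult.assoc)
        qed
        finally show "(\<integral>\<^sup>+y\<in>B z r. H y \<partial>M) \<le> (morrey_sup H\<^sub>0 + ennreal (C / (1 - 2 powr - (s * p))) * morrey_sup ?u) * W z r"
          by (simp add: distrib_right \<theta>_def)
      qed
    qed
  qed
qed

end

section \<open>Annuli and minorants of the energy\<close>

lemma one_minus_powr_le:
  fixes a z :: real
  assumes "0 < a" shows "1 - a powr - z \<le> z * ln a"
  using exp_ge_add_one_self[of "- (z * ln a)"] assms by (simp add: powr_def)

lemma one_minus_powr_ge:
  fixes z :: real
  assumes "1 < a" "0 < z" shows "z * ln a / (1 + z * ln a) \<le> 1 - a powr - z"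
proof -
  have z: "0 < z * ln a" using assms by simp
  have "exp (- (z * ln a)) \<le> inverse (1 + z * ln a)"
    unfolding exp_minus using exp_ge_add_one_self[of "z * ln a"] z by (intro le_imp_inverse_le) auto
  moreover have "z * ln a / (1 + z * ln a) = 1 - inverse (1 + z * ln a)"
    using z by (simp add: field_simps)
  ultimately show ?thesis using assms by (simp add: powr_def)
qed

context doubling_space
begin

lemma inter_ball_fmeasurable:
  assumes "x \<in> X" "\<Omega> \<in> sets M" shows "\<Omega> \<inter> B x r \<in> fmeasurable M"
proof (cases "0 < r")
  case True
  then have "B x r \<in> fmeasurable M" using assms(1) emeasure_ball_finite[of x r] by (intro fmeasurableI) auto
  then show ?thesis using assms by (intro fmeasurable_Int_fmeasurable[of "B x r" M \<Omega>, simplified Int_commute])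
qed (use assms ball_empty[of x r] in auto)

text \<open>
  Choose the number of steps so large that reverse doubling makes \<open>B x\<^sub>0 t\<close> have at most half the
  volume that \<open>\<Omega>\<close> is known to have in \<open>B x\<^sub>0 (\<Lambda> * t)\<close>; removing \<open>B x\<^sub>0 t\<close> then leaves the other half. The two
  conditions may come with different centres, so the density of \<open>\<Omega>\<close> is first moved from \<open>x\<^sub>1\<close> to \<open>x\<^sub>0\<close> by
  \<open>volume_comparison\<close>.
\<close>

lemma annuli_of_positive_density:
  assumes "weak_reverse_doubling M \<rho>" "weak_measure_density M \<rho> \<Omega>" and \<Omega>: "\<Omega> \<in> sets M"
  shows "\<exists>x\<^sub>0\<in>X. \<exists>\<Lambda>>1. \<exists>c>0. \<exists>t\<^sub>0. \<forall>t\<ge>t\<^sub>0. c * V x\<^sub>0 (\<Lambda> * t) \<le> measure M (\<Omega> \<inter> (B x\<^sub>0 (\<Lambda> * t) - B x\<^sub>0 t))"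
proof -
  obtain x\<^sub>0 \<Lambda> C where x0: "x\<^sub>0 \<in> X" and \<Lambda>: "1 < \<Lambda>" and C: "1 < C" "ennreal C \<le> Liminf at_top (\<lambda>r.
          emeasure M (B x\<^sub>0 (\<Lambda> * r)) / emeasure M (B x\<^sub>0 r))"
    using assms(1) unfolding weak_reverse_doubling_def by blast
  obtain x\<^sub>1 C\<^sub>0 where x1: "x\<^sub>1 \<in> X" and C0: "0 < C\<^sub>0" "ennreal C\<^sub>0 \<le> Liminf at_top (\<lambda>r.
          emeasure M (B x\<^sub>1 r \<inter> \<Omega>) / emeasure M (B x\<^sub>1 r))"
    using assms(2) unfolding weak_measure_density_def by blast
  \<comment> \<open>Since \<open>b < C\<close> and \<open>C\<^sub>0 / 2 < C\<^sub>0\<close>, the two ratios exceed these constants for all large radii.\<close>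
  define b where "b = (1 + C) / 2"
  have b: "1 < b" "b < C" using C(1) by (auto simp: b_def)
  have "ennreal b < ennreal C" using b by (simp add: ennreal_less_iff)
  then have "ennreal b < Liminf at_top (\<lambda>r. emeasure M (B x\<^sub>0 (\<Lambda> * r)) / emeasure M (B x\<^sub>0 r))"
    using C(2) by (rule less_le_trans)
  from less_LiminfD[OF this] obtain r1 where r1: "\<And>r. r1 \<le> r \<Longrightarrow>
      ennreal b < emeasure M (B x\<^sub>0 (\<Lambda> * r)) / emeasure M (B x\<^sub>0 r)"
    by (auto simp: eventually_at_top_linorder)
  have "ennreal (C\<^sub>0 / 2) < ennreal C\<^sub>0" using C0 by (simp add: ennreal_less_iff)
  then have "ennreal (C\<^sub>0 / 2) < Liminf at_top (\<lambda>r. emeasure M (B x\<^sub>1 r \<inter> \<Omega>) / emeasure M (B x\<^sub>1 r))"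
    using C0(2) by (rule less_le_trans)
  from less_LiminfD[OF this] obtain r2 where r2: "\<And>r. r2 \<le> r \<Longrightarrow>
      ennreal (C\<^sub>0 / 2) < emeasure M (B x\<^sub>1 r \<inter> \<Omega>) / emeasure M (B x\<^sub>1 r)"
    by (auto simp: eventually_at_top_linorder)
  have growth1: "b * V x\<^sub>0 r \<le> V x\<^sub>0 (\<Lambda> * r)" if "r1 \<le> r" "0 < r" for r
  proof -
    have "ennreal b < ennreal (V x\<^sub>0 (\<Lambda> * r) / V x\<^sub>0 r)"
      using r1[OF that(1)] x0 \<Lambda> that(2) V_pos[OF x0 that(2)] by (simp add: emeasure_ball divide_ennreal)
    then show ?thesis using b V_pos[OF x0 that(2)] by (simp add: ennreal_less_iff field_simps)
  qed
  have density1: "C\<^sub>0 / 2 * V x\<^sub>1 r \<le> measure M (\<Omega> \<inter> B x\<^sub>1 r)" if "r2 \<le> r" "0 < r" for r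
  proof -
    have "emeasure M (B x\<^sub>1 r \<inter> \<Omega>) = ennreal (measure M (\<Omega> \<inter> B x\<^sub>1 r))"
      using inter_ball_fmeasurable[OF x1 \<Omega>, of r] by (simp add: Int_commute emeasure_eq_measure2)
    then have "ennreal (C\<^sub>0 / 2) < ennreal (measure M (\<Omega> \<inter> B x\<^sub>1 r) / V x\<^sub>1 r)"
      using r2[OF that(1)] x1 that(2) V_pos[OF x1 that(2)] by (simp add: emeasure_ball divide_ennreal)
    then show ?thesis using C0 V_pos[OF x1 that(2)] by (simp add: ennreal_less_iff field_simps)
  qed
  have growth: "b ^ m * V x\<^sub>0 r \<le> V x\<^sub>0 (\<Lambda> ^ m * r)" if r: "r1 \<le> r" "0 < r" for m r
  proof (induction m)
    case (Suc m)
    have "1 * r \<le> \<Lambda> ^ m * r" using \<Lambda> r by (intro mult_right_mono) auto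
    then have *: "r1 \<le> \<Lambda> ^ m * r" "0 < \<Lambda> ^ m * r" using r by linarith+
    have "b ^ Suc m * V x\<^sub>0 r \<le> b * V x\<^sub>0 (\<Lambda> ^ m * r)" using Suc b by simp
    also have "\<dots> \<le> V x\<^sub>0 (\<Lambda> ^ Suc m * r)" using growth1[OF *] by (simp add: mult.assoc)
    finally show ?case .
  qed simp
  obtain D where D: "0 < D" "\<forall>x\<in>X. \<forall>y\<in>X. \<forall>r>0. \<rho> x y \<le> 1 * r \<longrightarrow> V x (2 * K * r) \<le> D * V y r"
    using volume_comparison[of 1 "2 * K"] K_ge_1 by auto
  define c where "c = C\<^sub>0 / (2 * D)"
  have c: "0 < c" using C0 D by (simp add: c_def)
  have density: "c * V x\<^sub>0 (2 * K * r) \<le> measure M (\<Omega> \<inter> B x\<^sub>0 (2 * K * r))" if r: "r2 \<le> r" "0 < r" "\<rho> x\<^sub>0 x\<^sub>1 \<le> r" for r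
  proof -
    have "B x\<^sub>1 r \<subseteq> B x\<^sub>0 (K * (r + r))"
      using x0 x1 r by (intro ball_subset_ball) (auto simp: rho_sym)
    then have sub: "\<Omega> \<inter> B x\<^sub>1 r \<subseteq> \<Omega> \<inter> B x\<^sub>0 (2 * K * r)" by (auto simp: algebra_simps)
    have "c * V x\<^sub>0 (2 * K * r) \<le> c * (D * V x\<^sub>1 r)"
      using D(2)[rule_format, of x\<^sub>0 x\<^sub>1 r] x0 x1 r c by (intro mult_left_mono) auto
    also have "\<dots> = C\<^sub>0 / 2 * V x\<^sub>1 r" using D by (simp add: c_def)
    also have "\<dots> \<le> measure M (\<Omega> \<inter> B x\<^sub>1 r)" using r by (intro density1)
    also have "\<dots> \<le> measure M (\<Omega> \<inter> B x\<^sub>0 (2 * K * r))"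
      using sub \<Omega> x0 x1 by (intro measure_mono_fmeasurable inter_ball_fmeasurable) auto
    finally show ?thesis .
  qed
  obtain m where m: "2 / c < b ^ m" using real_arch_pow[OF b(1)] by blast
  define t\<^sub>0 where "t\<^sub>0 = max 1 (max r1 (2 * K * max r2 (\<rho> x\<^sub>0 x\<^sub>1)))"
  \<comment> \<open>\<open>Suc m\<close> steps rather than \<open>m\<close>, so that the ratio exceeds \<open>1\<close> also for \<open>m = 0\<close>.\<close>
  define \<Lambda>' where "\<Lambda>' = \<Lambda> ^ Suc m"
  have \<Lambda>': "1 < \<Lambda>'" using \<Lambda> unfolding \<Lambda>'_def by (intro power_gt1) auto
  have m': "2 < c * b ^ Suc m"
  proof -
    have "2 < c * b ^ m" using m c by (simp add: field_simps)
    also have "\<dots> \<le> c * b ^ Suc m" using c b by simp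
    finally show ?thesis .
  qed
  show ?thesis
  proof (rule bexI[OF _ x0], rule exI[of _ \<Lambda>'], rule conjI[OF \<Lambda>'], rule exI[of _ "c / 2"],
      rule conjI[OF half_gt_zero[OF c]], rule exI[of _ t\<^sub>0], intro allI impI)
    fix t assume t: "t\<^sub>0 \<le> t"
    have tpos: "0 < t" and tr1: "r1 \<le> t" and t_far: "2 * K * max r2 (\<rho> x\<^sub>0 x\<^sub>1) \<le> t"
      using t by (auto simp: t\<^sub>0_def)
    have "1 * t \<le> \<Lambda>' * t" using \<Lambda>' tpos by (intro mult_right_mono) auto
    with t_far have "max r2 (\<rho> x\<^sub>0 x\<^sub>1) * (2 * K) \<le> \<Lambda>' * t" by (simp only: mult.commute mult_1_right)
    then have "max r2 (\<rho> x\<^sub>0 x\<^sub>1) \<le> \<Lambda>' * t / (2 * K)"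
      using K_ge_1 by (subst pos_le_divide_eq) auto
    then have "c * V x\<^sub>0 (\<Lambda>' * t) \<le> measure M (\<Omega> \<inter> B x\<^sub>0 (\<Lambda>' * t))"
      using density[of "\<Lambda>' * t / (2 * K)"] K_ge_1 \<Lambda>' tpos by simp
    also have "\<dots> \<le> measure M ((\<Omega> \<inter> (B x\<^sub>0 (\<Lambda>' * t) - B x\<^sub>0 t)) \<union> B x\<^sub>0 t)"
    proof (intro measure_mono_fmeasurable fmeasurable.Un)
      show "\<Omega> \<inter> (B x\<^sub>0 (\<Lambda>' * t) - B x\<^sub>0 t) \<in> fmeasurable M"
        using \<Omega> x0 by (intro fmeasurableI2[OF inter_ball_fmeasurable[OF x0 \<Omega>, of "\<Lambda>' * t"]]) auto
      show "B x\<^sub>0 t \<in> fmeasurable M" using x0 emeasure_ball_finite[OF x0 tpos] by (intro fmeasurableI) auto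
    qed (use x0 \<Omega> in auto)
    also have "\<dots> \<le> measure M (\<Omega> \<inter> (B x\<^sub>0 (\<Lambda>' * t) - B x\<^sub>0 t)) + V x\<^sub>0 t"
      using x0 \<Omega> by (intro measure_Un_le) auto
    also have "V x\<^sub>0 t \<le> c / 2 * V x\<^sub>0 (\<Lambda>' * t)"
    proof -
      have "2 * V x\<^sub>0 t \<le> c * b ^ Suc m * V x\<^sub>0 t" using m' by (intro mult_right_mono) auto
      also have "\<dots> \<le> c * V x\<^sub>0 (\<Lambda>' * t)" 
        using growth[OF tr1 tpos, of "Suc m"] c unfolding \<Lambda>'_def by (simp add: mult.assoc)
      finally show ?thesis by simp
    qed
    finally show "c / 2 * V x\<^sub>0 (\<Lambda>' * t) \<le> measure M (\<Omega> \<inter> (B x\<^sub>0 (\<Lambda>' * t) - B x\<^sub>0 t))" by simp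
  qed
qed

end

context morrey_weight
begin

text \<open>
  On an annulus around \<open>x\<^sub>0\<close> of radii \<open>t\<close> and \<open>\<Lambda> * t\<close> that is outside the support of \<open>f\<close>, the integrand is at least
  \<open>|f x|\<^sup>p\<close> divided by a multiple of \<open>V x\<^sub>0 (\<Lambda> * t)\<close> and by \<open>(2 * K * \<Lambda> * t) powr (s * p)\<close>, and \<open>\<Omega>\<close> occupies a fixed proportion of
  that volume. The disjoint annuli with \<open>t = \<Lambda> ^ k * T\<close> thus give a geometric series with sum at least
  \<open>1 / (s * p * ln \<Lambda>)\<close>, times a power \<open>a powr - (s * p)\<close> that tends to \<open>1\<close>. The radius \<open>R\<close> enters only this power:
  it determines \<open>\<delta>\<close>, but not \<open>c'\<close>.
\<close>

lemma energy_ge: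
  assumes x0: "x\<^sub>0 \<in> X" and \<Omega>: "\<Omega> \<in> sets M" and \<Lambda>: "1 < \<Lambda>" and c: "0 < c"
    and annuli: "\<And>t. t\<^sub>0 \<le> t \<Longrightarrow> c * V x\<^sub>0 (\<Lambda> * t) \<le> measure M (\<Omega> \<inter> (B x\<^sub>0 (\<Lambda> * t) - B x\<^sub>0 t))"
  shows "\<exists>c'>0. \<forall>R. \<exists>\<delta>>0. \<forall>s f. 0 < s \<longrightarrow> s < \<delta> \<longrightarrow> (\<forall>y\<in>\<Omega> - B x\<^sub>0 R. f y = 0) \<longrightarrow>
    (\<forall>x\<in>\<Omega>. ennreal (c' / s) * pow_norm f x \<le> energy \<Omega> s f x)"
proof -
  have K: "0 < K" using K_ge_1 by simp
  obtain D where D: "0 < D" "\<forall>x\<in>X. \<forall>y\<in>X. \<forall>r>0. \<rho> x y \<le> 1 * r \<longrightarrow> V x (2 * K * r) \<le> D * V y r"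
    using volume_comparison[of 1 "2 * K"] K by auto
  define c' where "c' = c / (2 * D * p * ln \<Lambda>)"
  have c': "0 < c'" using c D p_pos \<Lambda> by (simp add: c'_def)
  show ?thesis
  proof (rule exI[of _ c'], rule conjI[OF c'], rule allI)
    fix R
    define T where "T = max R (max t\<^sub>0 1)"
    define a where "a = 2 * K * \<Lambda> * T"
    define \<delta> where "\<delta> = 1 / (2 * p * (ln a + 1))"
    have T: "1 \<le> T" "R \<le> T" "t\<^sub>0 \<le> T" by (auto simp: T_def)
    have "1 * 1 * 1 \<le> (2 * K) * \<Lambda> * T" using K_ge_1 \<Lambda> T by (intro mult_mono) auto
    then have a: "1 \<le> a" by (simp add: a_def)
    have \<delta>: "0 < \<delta>" using p_pos a by (simp add: \<delta>_def add_nonneg_pos)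
    have "ennreal (c' / s) * pow_norm f x \<le> energy \<Omega> s f x"
      if s: "0 < s" "s < \<delta>" and f: "\<forall>y\<in>\<Omega> - B x\<^sub>0 R. f y = 0" and x: "x \<in> \<Omega>" for s f x
    proof (cases "x \<in> B x\<^sub>0 R")
      case xR: True
      define t where "t k = \<Lambda> ^ k * T" for k :: nat
      define A where "A k = \<Omega> \<inter> (B x\<^sub>0 (\<Lambda> * t k) - B x\<^sub>0 (t k))" for k
      define w where "w = norm (f x) powr p"
      define g where "g k = w / (D * V x\<^sub>0 (\<Lambda> * t k) * (a * \<Lambda> ^ k) powr (s * p))" for k
      have xX: "x \<in> X" using xR by (simp add: qball_def)
      have tT: "T \<le> t k" for k
        using T \<Lambda> mult_right_mono[of 1 "\<Lambda> ^ k" T] by (simp add: t_def)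
      have t_Suc: "t (Suc k) = \<Lambda> * t k" for k by (simp add: t_def)
      have t_mono: "t i \<le> t j" if "i \<le> j" for i j
        using that \<Lambda> T by (auto simp: t_def intro!: mult_right_mono power_increasing)
      have V0: "0 < V x\<^sub>0 (\<Lambda> * t k)" for k
        using x0 \<Lambda> T tT[of k] by (intro V_pos) auto
      have A [measurable]: "A k \<in> sets M" for k
        unfolding A_def using \<Omega> x0 by auto
      have disj: "disjoint_family A"
        unfolding disjoint_family_on_def
      proof (intro ballI impI)
        fix i j :: nat assume "i \<noteq> j"
        then have "Suc i \<le> j \<or> Suc j \<le> i" by auto
        then have "t (Suc i) \<le> t j \<or> t (Suc j) \<le> t i" using t_mono by blast
        then show "A i \<inter> A j = {}" unfolding t_Suc by (auto simp: A_def qball_def)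
      qed
      have pointwise: "(\<Sum>k. ennreal (g k) * indicator (A k) y) \<le> (if y = x then 0
          else ennreal (norm (f x - f y) powr p / (U_fun M \<rho> x y * \<rho> x y powr (s * p)))) * indicator \<Omega> y" for y
      proof (cases "\<exists>k. y \<in> A k")
        case True
        then obtain k where y: "y \<in> A k" by blast
        then have yX: "y \<in> X" and y\<Omega>: "y \<in> \<Omega>" and y_lt: "\<rho> x\<^sub>0 y < \<Lambda> * t k" and y_ge: "t k \<le> \<rho> x\<^sub>0 y"
          by (auto simp: A_def qball_def)
        have x_lt: "\<rho> x\<^sub>0 x < t k" using xR T tT[of k] by (auto simp: qball_def)
        have "y \<notin> B x\<^sub>0 R" using y_ge T tT[of k] by (simp add: qball_def)
        then have fy: "f y = 0" using f y\<Omega> by blast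
        have "x \<noteq> y" using x_lt y_ge by auto
        then have rho: "0 < \<rho> x y" using rho_nonneg[OF xX yX] rho_eq_0[OF xX yX] by (auto simp: less_le)
        have tk: "0 < t k" using T tT[of k] by simp
        have t\<Lambda>: "t k \<le> \<Lambda> * t k" using \<Lambda> tk by simp
        have "\<rho> x y \<le> K * (\<rho> x x\<^sub>0 + \<rho> x\<^sub>0 y)" using xX yX x0 by (intro rho_triangle)
        also have "\<dots> \<le> K * (\<Lambda> * t k + \<Lambda> * t k)"
          using x_lt y_lt t\<Lambda> K rho_sym[OF xX x0] by (intro mult_left_mono add_mono) auto
        finally have rho_le: "\<rho> x y \<le> 2 * K * (\<Lambda> * t k)" by simp
        have "U_fun M \<rho> x y \<le> V x (\<rho> x y)" by (simp add: U_fun_def)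
        also have "\<dots> \<le> V x (2 * K * (\<Lambda> * t k))"
          using xX rho rho_le by (intro V_mono ball_mono) auto
        also have "\<dots> \<le> D * V x\<^sub>0 (\<Lambda> * t k)"
          using D(2)[rule_format, of x x\<^sub>0 "\<Lambda> * t k"] xX x0 rho_sym[OF xX x0] x_lt t\<Lambda> tk by simp
        finally have U_le: "U_fun M \<rho> x y \<le> D * V x\<^sub>0 (\<Lambda> * t k)" .
        have U_pos: "0 < U_fun M \<rho> x y"
          using V_pos[OF xX rho] V_pos[OF yX rho] by (simp add: U_fun_def)
        have "\<rho> x y \<le> a * \<Lambda> ^ k" using rho_le by (simp add: a_def t_def ac_simps)
        then have "\<rho> x y powr (s * p) \<le> (a * \<Lambda> ^ k) powr (s * p)"
          using rho s p_pos by (intro powr_mono2) auto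
        then have "g k \<le> w / (U_fun M \<rho> x y * \<rho> x y powr (s * p))"
          unfolding g_def using U_le U_pos rho D(1) V0[of k] a \<Lambda>
          by (intro divide_left_mono mult_mono mult_pos_pos) (auto simp: w_def)
        then show ?thesis
          using suminf_cmult_indicator[OF disj y, of "\<lambda>k. ennreal (g k)"] \<open>x \<noteq> y\<close> y\<Omega> fy
          by (auto simp: w_def intro: ennreal_leI)
      next
        case False
        then have "(\<Sum>k. ennreal (g k) * indicator (A k) y) = 0" by simp
        then show ?thesis by simp
      qed
      define \<theta> where "\<theta> = \<Lambda> powr - (s * p)"
      have \<theta>: "0 < \<theta>" "\<theta> < 1" using s p_pos \<Lambda> by (auto simp: \<theta>_def powr_less_one)
      have w: "0 \<le> w" by (simp add: w_def)
      have a_half: "1 / 2 \<le> a powr - (s * p)"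
      proof -
        have "0 < 2 * p * (ln a + 1)" using p_pos a by (simp add: add_nonneg_pos)
        then have "s * (2 * p * (ln a + 1)) \<le> 1"
          using s(2) unfolding \<delta>_def by (simp only: pos_less_divide_eq less_imp_le)
        moreover have "s * (2 * p * (ln a + 1)) = 2 * (s * p * ln a) + 2 * (s * p)" by (simp add: algebra_simps)
        moreover have "0 < s * p" using s p_pos by simp
        ultimately have "s * p * ln a \<le> 1 / 2" by linarith
        with one_minus_powr_le[of a "s * p"] a show ?thesis by simp
      qed
      have g_nonneg: "0 \<le> g k" for k using w D V0[of k] by (simp add: g_def less_imp_le)
      have summand: "w * c / D * a powr - (s * p) * \<theta> ^ k \<le> g k * measure M (A k)" for k
      proof -
        have "\<theta> ^ k = (\<Lambda> ^ k) powr - (s * p)"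
          using \<Lambda> by (simp add: \<theta>_def powr_powr powr_realpow[symmetric] mult.commute powr_power)
        then have "a powr - (s * p) * \<theta> ^ k = 1 / (a * \<Lambda> ^ k) powr (s * p)"
          using a \<Lambda> by (simp add: powr_mult powr_minus field_simps)
        then have "w * c / D * a powr - (s * p) * \<theta> ^ k = g k * (c * V x\<^sub>0 (\<Lambda> * t k))"
          using V0[of k] by (simp add: g_def field_simps)
        also have "\<dots> \<le> g k * measure M (A k)"
          unfolding A_def using annuli[of "t k"] T tT[of k] g_nonneg[of k] by (intro mult_left_mono) auto
        finally show ?thesis .
      qed
      have "c' / s * w \<le> w * c / D * a powr - (s * p) * (1 / (1 - \<theta>))"
      proof -
        have "1 - \<theta> \<le> s * p * ln \<Lambda>" unfolding \<theta>_def using one_minus_powr_le[of \<Lambda> "s * p"] \<Lambda> by simp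
        then have "1 / (s * p * ln \<Lambda>) \<le> 1 / (1 - \<theta>)" using \<theta> by (intro divide_left_mono) auto
        then have "w * c / D * (1 / 2) * (1 / (s * p * ln \<Lambda>)) \<le> w * c / D * a powr - (s * p) * (1 / (1 - \<theta>))"
          using a_half w c D s p_pos \<Lambda> by (intro mult_mono) auto
        then show ?thesis by (simp add: c'_def ac_simps)
      qed
      then have "ennreal (c' / s) * pow_norm f x \<le> ennreal (w * c / D * a powr - (s * p) * (1 / (1 - \<theta>)))"
        using c' s unfolding w_def by (simp add: ennreal_mult'[symmetric] ennreal_leI)
      also have "\<dots> = (\<Sum>k. ennreal (w * c / D * a powr - (s * p) * \<theta> ^ k))"
        using w c D(1) \<theta> by (intro suminf_ennreal_eq[symmetric] sums_mult geometric_sums) auto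
      also have "\<dots> \<le> (\<Sum>k. ennreal (g k * measure M (A k)))"
        by (intro suminf_le ennreal_leI summand summableI)
      also have "\<dots> = (\<Sum>k. \<integral>\<^sup>+y. ennreal (g k) * indicator (A k) y \<partial>M)"
      proof (rule suminf_cong)
        fix k
        have "A k \<in> fmeasurable M"
          by (rule fmeasurableI2[OF inter_ball_fmeasurable[OF x0 \<Omega>, of "\<Lambda> * t k"] _ A]) (auto simp: A_def)
        then show "ennreal (g k * measure M (A k)) = (\<integral>\<^sup>+y. ennreal (g k) * indicator (A k) y \<partial>M)"
          using g_nonneg[of k] by (simp add: nn_integral_cmult_indicator A emeasure_eq_measure2 ennreal_mult)
      qed
      also have "\<dots> = (\<integral>\<^sup>+y. (\<Sum>k. ennreal (g k) * indicator (A k) y) \<partial>M)"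
        by (rule nn_integral_suminf[symmetric]) measurable
      also have "\<dots> \<le> energy \<Omega> s f x"
        unfolding energy_def by (intro nn_integral_mono pointwise)
      finally show ?thesis .
    next
      case False
      then show ?thesis using f x p_pos by simp
    qed
    then show "\<exists>\<delta>>0. \<forall>s f. 0 < s \<longrightarrow> s < \<delta> \<longrightarrow> (\<forall>y\<in>\<Omega> - B x\<^sub>0 R. f y = 0) \<longrightarrow>
      (\<forall>x\<in>\<Omega>. ennreal (c' / s) * pow_norm f x \<le> energy \<Omega> s f x)"
      using \<delta> by blast
  qed
qed

end

section \<open>The limit of the seminorms\<close>

context morrey_weight
begin

text \<open>
  The seminorm is an infimum over majorants, and each of them is also a majorant of \<open>(c / s) |f|\<^sup>p\<close> on \<open>\<Omega>\<close>.
\<close>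

lemma seminorm_ge:
  assumes \<Omega>: "\<Omega> \<in> sets M" and f: "f \<in> borel_measurable (restrict_space M \<Omega>)" and s: "0 < s" and c: "0 < c"
    and lower: "\<And>x. x \<in> \<Omega> \<Longrightarrow> ennreal (c / s) * pow_norm f x \<le> energy \<Omega> s f x"
  shows "ennreal (c powr (1 / p)) * morrey_norm_on M \<rho> p \<phi> \<Omega> f
    \<le> ennreal (s powr (1 / p)) * morrey_norm_on_ennreal M \<rho> p \<phi> \<Omega> (gagliardo M \<rho> p \<Omega> s f)"
proof -
  let ?u = "restricted_pow \<Omega> f"
  have p': "0 < 1 / p" using p_pos by simp
  have u: "?u \<in> borel_measurable M" using \<Omega> f by (rule restricted_pow_measurable)
  have "ennpowr (ennreal (c / s) * morrey_sup ?u) (1 / p) \<le> morrey_norm_on_ennreal M \<rho> p \<phi> \<Omega> (gagliardo M \<rho> p \<Omega> s f)"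
    unfolding gagliardo_eq morrey_norm_on_ennreal_eq[OF \<Omega>]
  proof (rule INF_greatest, clarify)
    fix H assume H: "AE x in M. x \<in> \<Omega> \<longrightarrow> energy \<Omega> s f x \<le> H x"
    have "morrey_sup (\<lambda>x. ennreal (c / s) * ?u x) \<le> morrey_sup H"
    proof (rule morrey_sup_mono_AE)
      show "AE x in M. ennreal (c / s) * ?u x \<le> H x"
        using H
      proof eventually_elim
        case (elim x)
        then show ?case using lower[of x] by (cases "x \<in> \<Omega>") auto
      qed
    qed
    then show "ennpowr (ennreal (c / s) * morrey_sup ?u) (1 / p) \<le> ennpowr (morrey_sup H) (1 / p)"
      unfolding morrey_sup_cmult[OF u] using p' by (intro ennpowr_mono) auto
  qed
  then have "ennreal (s powr (1 / p)) * ennpowr (ennreal (c / s) * morrey_sup ?u) (1 / p)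
    \<le> ennreal (s powr (1 / p)) * morrey_norm_on_ennreal M \<rho> p \<phi> \<Omega> (gagliardo M \<rho> p \<Omega> s f)"
    by (rule mult_left_mono) simp
  moreover have "ennreal (s powr (1 / p)) * ennpowr (ennreal (c / s) * morrey_sup ?u) (1 / p) =
      ennreal (c powr (1 / p)) * morrey_norm_on M \<rho> p \<phi> \<Omega> f"
    using s c p' by (simp add: morrey_norm_on_eq[OF \<Omega> f] ennpowr_mult[OF p'] ennpowr_ennreal
        ennreal_mult[symmetric] powr_mult[symmetric] flip: mult.assoc)
  ultimately show ?thesis by simp
qed

text \<open>
  The \<open>p\<close>-th power of the rescaled seminorm is at most \<open>s * h + Q * q\<close>, where \<open>h\<close> comes from the finite
  seminorm of exponent \<open>s\<^sub>0\<close>, \<open>q\<close> is \<open>morrey_sup\<close> of \<open>|f|\<^sup>p\<close>, and \<open>Q\<close> bounds the product of \<open>s\<close> and the total weight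
  of the averages. The first term vanishes in the limit.
\<close>

lemma limsup_seminorm_le:
  "\<exists>C>0. \<forall>\<Omega>\<in>sets M. \<forall>f\<in>\<Union>s\<in>{0<..<1}. W_dot M \<rho> p \<phi> \<Omega> s.
     Limsup (at_right 0) (\<lambda>s. ennreal (s powr (1 / p)) *
       morrey_norm_on_ennreal M \<rho> p \<phi> \<Omega> (gagliardo M \<rho> p \<Omega> s f)) \<le> ennreal C * morrey_norm_on M \<rho> p \<phi> \<Omega> f"
proof -
  have p': "0 < 1 / p" using p_pos by simp
  obtain C where C: "0 < C" "\<forall>\<Omega>\<in>sets M. \<forall>f\<in>borel_measurable (restrict_space M \<Omega>). \<forall>s\<^sub>0. \<forall>H\<^sub>0\<in>borel_measurable M.
     (AE x in M. x \<in> \<Omega> \<longrightarrow> energy \<Omega> s\<^sub>0 f x \<le> H\<^sub>0 x) \<longrightarrow> (\<forall>s. 0 < s \<longrightarrow> s \<le> s\<^sub>0 \<longrightarrow>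
       (\<exists>H\<in>borel_measurable M. (AE x in M. x \<in> \<Omega> \<longrightarrow> energy \<Omega> s f x \<le> H x) \<and>
          morrey_sup H \<le> morrey_sup H\<^sub>0 + ennreal (C / (1 - 2 powr - (s * p))) * morrey_sup (restricted_pow \<Omega> f)))"
    using energy_majorant by blast
  define Q where "Q = C * (1 + p * ln 2) / (p * ln 2)"
  have Q: "0 < Q" using C p_pos by (simp add: Q_def add_pos_pos)
  have sQ: "s * (C / (1 - 2 powr - (s * p))) \<le> Q" if s: "0 < s" "s < 1" for s
  proof -
    have sp: "0 < s * p * ln 2" using s p_pos by simp
    then have sp1: "0 < 1 + s * p * ln 2" by simp
    have "1 / (1 - 2 powr - (s * p)) \<le> 1 / (s * p * ln 2 / (1 + s * p * ln 2))"
      using one_minus_powr_ge[of 2 "s * p"] sp sp1 s p_pos powr_less_one[of 2 "- (s * p)"]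
      by (intro divide_left_mono mult_pos_pos divide_pos_pos) auto
    also have "\<dots> \<le> (1 + p * ln 2) / (s * p * ln 2)"
      using s p_pos sp by (auto intro!: divide_right_mono)
    finally have "s * C * (1 / (1 - 2 powr - (s * p))) \<le> s * C * ((1 + p * ln 2) / (s * p * ln 2))"
      using s C by (intro mult_left_mono) auto
    also have "\<dots> = Q" using s by (simp add: Q_def)
    finally show ?thesis by simp
  qed
  show ?thesis
  proof (intro exI[of _ "Q powr (1 / p)"] conjI ballI)
    show "0 < Q powr (1 / p)" using Q by simp
    fix \<Omega> f assume \<Omega>: "\<Omega> \<in> sets M" and "f \<in> (\<Union>s\<in>{0<..<1}. W_dot M \<rho> p \<phi> \<Omega> s)"
    then obtain s\<^sub>0 where s0: "0 < s\<^sub>0" "s\<^sub>0 < 1" and f: "f \<in> borel_measurable (restrict_space M \<Omega>)"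
      and fin: "morrey_norm_on_ennreal M \<rho> p \<phi> \<Omega> (gagliardo M \<rho> p \<Omega> s\<^sub>0 f) < \<infinity>"
      by (auto simp: W_dot_def)
    let ?u = "restricted_pow \<Omega> f"
    let ?N = "\<lambda>s. ennreal (s powr (1 / p)) * morrey_norm_on_ennreal M \<rho> p \<phi> \<Omega> (gagliardo M \<rho> p \<Omega> s f)"
    from fin obtain H\<^sub>0 where H0: "H\<^sub>0 \<in> borel_measurable M" "AE x in M. x \<in> \<Omega> \<longrightarrow> energy \<Omega> s\<^sub>0 f x \<le> H\<^sub>0 x"
      and H0_fin: "ennpowr (morrey_sup H\<^sub>0) (1 / p) < \<infinity>"
      unfolding gagliardo_eq morrey_norm_on_ennreal_eq[OF \<Omega>] INF_less_iff by blast
    show "Limsup (at_right 0) ?N \<le> ennreal (Q powr (1 / p)) * morrey_norm_on M \<rho> p \<phi> \<Omega> f"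
    proof (cases "morrey_sup ?u")
      case top
      then show ?thesis using Q by (simp add: morrey_norm_on_eq[OF \<Omega> f] ennreal_mult_top)
    next
      case (real q)
      obtain h where h: "0 \<le> h" "morrey_sup H\<^sub>0 = ennreal h"
        using H0_fin by (cases "morrey_sup H\<^sub>0") auto
      have bound: "?N s \<le> ennreal ((s * h + Q * q) powr (1 / p))" if s: "0 < s" "s < s\<^sub>0" for s
      proof -
        let ?g = "C / (1 - 2 powr - (s * p))"
        have g: "0 \<le> ?g" using C(1) s p_pos powr_less_one[of 2 "- (s * p)"] by simp
        obtain H where H: "H \<in> borel_measurable M" "AE x in M. x \<in> \<Omega> \<longrightarrow> energy \<Omega> s f x \<le> H x"
            "morrey_sup H \<le> morrey_sup H\<^sub>0 + ennreal ?g * morrey_sup ?u"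
          using C(2) \<Omega> f H0 s by (meson less_imp_le)
        have "morrey_norm_on_ennreal M \<rho> p \<phi> \<Omega> (gagliardo M \<rho> p \<Omega> s f) \<le> ennpowr (morrey_sup H) (1 / p)"
          unfolding gagliardo_eq morrey_norm_on_ennreal_eq[OF \<Omega>] using H by (intro INF_lower) auto
        also have "\<dots> \<le> ennpowr (ennreal (h + ?g * q)) (1 / p)"
        proof (intro ennpowr_mono)
          have "ennreal (h + ?g * q) = ennreal h + ennreal ?g * ennreal q"
            using h(1) g real(1) by (simp only: ennreal_plus ennreal_mult mult_nonneg_nonneg)
          then show "morrey_sup H \<le> ennreal (h + ?g * q)" using H(3) h(2) real(2) by simp
        qed (use p' in simp)
        finally have "?N s \<le> ennreal (s powr (1 / p)) * ennpowr (ennreal (h + ?g * q)) (1 / p)"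
          by (rule mult_left_mono) simp
        also have "\<dots> = ennreal ((s * (h + ?g * q)) powr (1 / p))"
        proof -
          have "0 \<le> h + ?g * q" using h(1) g real(1) by (intro add_nonneg_nonneg mult_nonneg_nonneg)
          then show ?thesis using s(1) by (simp only: ennpowr_ennreal powr_mult ennreal_mult powr_ge_zero less_imp_le)
        qed
        also have "\<dots> \<le> ennreal ((s * h + Q * q) powr (1 / p))"
        proof (intro ennreal_leI powr_mono2)
          have "s * ?g * q \<le> Q * q" using sQ[of s] s s0 real by (intro mult_right_mono) auto
          then show "s * (h + ?g * q) \<le> s * h + Q * q" by (simp add: algebra_simps)
          show "0 \<le> s * (h + ?g * q)" using s h(1) g real by (intro mult_nonneg_nonneg add_nonneg_nonneg) auto
        qed (use p' in auto)
        finally show ?thesis .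
      qed
      have "Limsup (at_right 0) ?N \<le> Limsup (at_right 0) (\<lambda>s. ennreal ((s * h + Q * q) powr (1 / p)))"
        using s0 bound by (intro Limsup_mono) (auto simp: eventually_at_right_field)
      also have "\<dots> = ennreal ((Q * q) powr (1 / p))"
      proof (intro lim_imp_Limsup tendsto_ennrealI)
        have "((\<lambda>s. s * h + Q * q) \<longlongrightarrow> 0 * h + Q * q) (at_right 0)" by (intro tendsto_intros)
        moreover have "\<forall>\<^sub>F s in at_right 0. 0 \<le> s * h + Q * q"
          using h(1) Q real by (intro eventually_at_right_less[THEN eventually_mono]) auto
        ultimately have "((\<lambda>s. (s * h + Q * q) powr (1 / p)) \<longlongrightarrow> (0 * h + Q * q) powr (1 / p)) (at_right 0)"
          using p' by (intro tendsto_powr2 tendsto_const)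
        then show "((\<lambda>s. (s * h + Q * q) powr (1 / p)) \<longlongrightarrow> (Q * q) powr (1 / p)) (at_right 0)" by simp
      qed (rule trivial_limit_at_right_real)
      also have "\<dots> = ennreal (Q powr (1 / p)) * morrey_norm_on M \<rho> p \<phi> \<Omega> f"
        using Q real by (simp add: morrey_norm_on_eq[OF \<Omega> f] ennpowr_ennreal powr_mult ennreal_mult)
      finally show ?thesis .
    qed
  qed
qed

end

theorem theorem4p16:
  fixes M :: "'a measure" and \<rho> :: "'a \<Rightarrow> 'a \<Rightarrow> real" and \<Omega> :: "'a set"
    and p \<beta> :: real and \<phi> :: "'a \<Rightarrow> real \<Rightarrow> real"
  assumes "homogeneous_type M \<rho>"
    and "weak_reverse_doubling M \<rho>"
    and "qopen (space M) \<rho> \<Omega>"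
    and "weak_measure_density M \<rho> \<Omega>"
    and "0 < p" and "0 < \<beta>"
    and "\<phi> \<in> G_dec M \<rho> p"
    and "nearness (space M) \<rho> \<phi>"
    and "\<exists>C>0. \<forall>x\<in>space M. \<forall>r>0.
           (\<integral>\<^sup>+t\<in>{r<..}. ennreal (\<phi> x t / t) \<partial>lborel) \<le> ennreal (C * \<phi> x r)"
    and "(\<exists>C\<ge>1. \<forall>x\<in>space M. \<forall>r>0.
            1 / C \<le> \<phi> x r * measure M (qball (space M) \<rho> x r) powr (1 / p) \<and>
            \<phi> x r * measure M (qball (space M) \<rho> x r) powr (1 / p) \<le> C) \<or>
         ((\<forall>z\<in>space M. \<forall>R>0.
             filterlim (\<lambda>r. INF x\<in>qball (space M) \<rho> z R. \<phi> x r) at_top (at_right 0)) \<and>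
          (\<forall>x\<in>space M.
             filterlim (\<lambda>r. \<phi> x r * measure M (qball (space M) \<rho> x r) powr (1 / p)) at_top at_top))"
  shows "\<exists>C C'. 0 < C \<and> 0 < C' \<and>
    (\<forall>f \<in> Holder_b_on (space M) \<rho> \<beta> \<Omega> \<inter> (\<Union>s\<in>{0<..<1}. W_dot M \<rho> p \<phi> \<Omega> s).
       ennreal C * morrey_norm_on M \<rho> p \<phi> \<Omega> f
         \<le> Liminf (at_right 0) (\<lambda>s. ennreal (s powr (1 / p)) *
              morrey_norm_on_ennreal M \<rho> p \<phi> \<Omega> (gagliardo M \<rho> p \<Omega> s f)) \<and>
       Liminf (at_right 0) (\<lambda>s. ennreal (s powr (1 / p)) *
              morrey_norm_on_ennreal M \<rho> p \<phi> \<Omega> (gagliardo M \<rho> p \<Omega> s f))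
         \<le> Limsup (at_right 0) (\<lambda>s. ennreal (s powr (1 / p)) *
              morrey_norm_on_ennreal M \<rho> p \<phi> \<Omega> (gagliardo M \<rho> p \<Omega> s f)) \<and>
       Limsup (at_right 0) (\<lambda>s. ennreal (s powr (1 / p)) *
              morrey_norm_on_ennreal M \<rho> p \<phi> \<Omega> (gagliardo M \<rho> p \<Omega> s f))
         \<le> ennreal C' * morrey_norm_on M \<rho> p \<phi> \<Omega> f)"
  proof -
  obtain K L where "doubling_space M \<rho> K L" using assms(1) by (rule doubling_space_if_homogeneous_type)
  then interpret morrey_weight M \<rho> K L p \<phi> using assms(5,7,8) by (rule morrey_weight_if_G_dec)
  have \<Omega>: "\<Omega> \<in> sets M" using assms(3) by (rule qopen_sets)
  obtain x\<^sub>0 \<Lambda> c t\<^sub>0 where x0: "x\<^sub>0 \<in> space M" and "1 < \<Lambda>" "0 < c"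
      "\<And>t. t\<^sub>0 \<le> t \<Longrightarrow> c * V x\<^sub>0 (\<Lambda> * t) \<le> measure M (\<Omega> \<inter> (B x\<^sub>0 (\<Lambda> * t) - B x\<^sub>0 t))"
    using annuli_of_positive_density[OF assms(2,4) \<Omega>] by blast
  from energy_ge[OF x0 \<Omega> this(2-4)] obtain c' where c': "0 < c'"
    "\<And>R. \<exists>\<delta>>0. \<forall>s f. 0 < s \<longrightarrow> s < \<delta> \<longrightarrow> (\<forall>y\<in>\<Omega> - B x\<^sub>0 R. f y = 0) \<longrightarrow>
       (\<forall>x\<in>\<Omega>. ennreal (c' / s) * pow_norm f x \<le> energy \<Omega> s f x)"
    by blast
  obtain C' where C': "0 < C'" "\<forall>f\<in>\<Union>s\<in>{0<..<1}. W_dot M \<rho> p \<phi> \<Omega> s.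
      Limsup (at_right 0) (\<lambda>s. ennreal (s powr (1 / p)) *
        morrey_norm_on_ennreal M \<rho> p \<phi> \<Omega> (gagliardo M \<rho> p \<Omega> s f)) \<le> ennreal C' * morrey_norm_on M \<rho> p \<phi> \<Omega> f"
    using limsup_seminorm_le \<Omega> by blast
  show ?thesis
  proof (rule exI[of _ "c' powr (1 / p)"], rule exI[of _ C'], intro conjI ballI)
    show "0 < c' powr (1 / p)" using c'(1) by simp
    show "0 < C'" by fact
    fix f assume f: "f \<in> Holder_b_on (space M) \<rho> \<beta> \<Omega> \<inter> (\<Union>s\<in>{0<..<1}. W_dot M \<rho> p \<phi> \<Omega> s)"
    let ?N = "\<lambda>s. ennreal (s powr (1 / p)) * morrey_norm_on_ennreal M \<rho> p \<phi> \<Omega> (gagliardo M \<rho> p \<Omega> s f)"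
    have f_meas: "f \<in> borel_measurable (restrict_space M \<Omega>)" using f by (auto simp: W_dot_def)
    obtain g where gH: "g \<in> Holder_b (space M) \<rho> \<beta>" and g: "\<forall>x\<in>\<Omega>. g x = f x"
      using f by (auto simp: Holder_b_on_def)
    from gH obtain x\<^sub>1 r where x1: "x\<^sub>1 \<in> space M" and supp: "{y\<in>space M. g y \<noteq> 0} \<subseteq> B x\<^sub>1 r"
      unfolding Holder_b_def mem_Collect_eq by blast
    have "B x\<^sub>1 r \<subseteq> B x\<^sub>0 (K * (\<rho> x\<^sub>1 x\<^sub>0 + r))" using x0 x1 by (intro ball_subset_ball) auto
    moreover have "\<Omega> \<subseteq> space M" using \<Omega> by (rule sets.sets_into_space)
    ultimately have f0: "\<forall>y\<in>\<Omega> - B x\<^sub>0 (K * (\<rho> x\<^sub>1 x\<^sub>0 + r)). f y = 0"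
      using g supp by force
    obtain \<delta> where \<delta>: "0 < \<delta>" "\<And>s x. 0 < s \<Longrightarrow> s < \<delta> \<Longrightarrow> x \<in> \<Omega> \<Longrightarrow>
        ennreal (c' / s) * pow_norm f x \<le> energy \<Omega> s f x"
      using c'(2)[of "K * (\<rho> x\<^sub>1 x\<^sub>0 + r)"] f0 by blast
    show "ennreal (c' powr (1 / p)) * morrey_norm_on M \<rho> p \<phi> \<Omega> f \<le> Liminf (at_right 0) ?N"
    proof (rule Liminf_bounded)
      show "\<forall>\<^sub>F s in at_right 0. ennreal (c' powr (1 / p)) * morrey_norm_on M \<rho> p \<phi> \<Omega> f \<le> ?N s"
        unfolding eventually_at_right_field
        using \<delta> by (intro exI[of _ \<delta>] conjI allI impI seminorm_ge[OF \<Omega> f_meas _ c'(1)]) auto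
    qed
    show "Liminf (at_right 0) ?N \<le> Limsup (at_right 0) ?N"
      by (rule Liminf_le_Limsup) (rule trivial_limit_at_right_real)
    show "Limsup (at_right 0) ?N \<le> ennreal C' * morrey_norm_on M \<rho> p \<phi> \<Omega> f"
      using C'(2) f by blast
  qed
qed

end
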